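(* Let the initial configuration be $(0,0,\alpha)$ and the final configuration $(d,0,\beta)$ with $d>0$, and suppose $(\alpha,\beta)$ lies in class $a_{12}$, i.e. $\alpha\in[0,\pi/2]$ and $\beta\in[\pi/2,\pi]$. Suppose we are in the short path case, i.e. $(C_{il}\cup C_{ir})\cap(C_{fl}\cup C_{fr})\neq\emptyset$. Define $S_{12}^1 = 2(p_{rlr}-\pi)-p_{rsr}$ and $S_{12}^2 = 2(t_{rlr}+q_{rlr})-(p_{lsr}+2q_{lsr})+2\pi$. Then the shortest Dubins path from the initial to the final configuration is of the following type: (i) if $C_{il}\cap C_{fr}=\emptyset$ and $t_{rsr}<\pi$: RLR if $S_{12}^1<0$, RSR if $S_{12}^1>0$; (ii) if $C_{il}\cap C_{fr}=\emptyset$ and $t_{rsr}>\pi$: RLR if $S_{12}^2<0$, LSR if $S_{12}^2>0$; (iii) if $C_{il}\cap C_{fr}\neq\emptyset$: LRL.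
   Context: A configuration $(x,y,\phi)$ consists of a planar position and a heading angle $\phi$ measured counterclockwise from the positive $x$-axis. Paths have minimal turning radius $1$. A Dubins path consists of three segments, each a left-turning arc of radius 1 (L), a right-turning arc of radius 1 (R), or a straight segment (S); the six types (letters in order of travel) are LSL, RSR, LSR, RSL, RLR, LRL. By Dubins' theorem the shortest curvature-bounded path between two configurations is one of these six; "the shortest Dubins path" is the shortest among them. After a rigid motion the initial configuration is $(0,0,\alpha)$ and the final $(d,0,\beta)$, $d$ the Euclidean distance between the positions. For a type $w\in\{lsl,rsr,lsr,rsl,rlr,lrl\}$, $t_w,p_w,q_w$ denote the lengths of the first, middle and final segments of the path of type $w$ joining $(0,0,\alpha)$ to $(d,0,\beta)$ (arc lengths taken in $[0,2\pi)$); for the types RLR and LRL the middle arc is the one of the standard Dubins construction, with length $p_w\in[\pi,2\pi)$. The circles $C_{il},C_{ir}$ are the unit circles tangent to the initial heading at $(0,0)$ on its left and right, with centers $(-\sin\alpha,\cos\alpha)$ and $(\sin\alpha,-\cos\alpha)$; $C_{fl},C_{fr}$ are the unit circles tangent to the final heading at $(d,0)$ on its left and right, with centers $(d-\sin\beta,\cos\beta)$ and $(d+\sin\beta,-\cos\beta)$. Intersections are of the circles as point sets in the plane. The class $a_{ij}$ means $\alpha$ lies in the $i$-th and $\beta$ in the $j$-th quadrant, quadrants being $[0,\pi/2],[\pi/2,\pi],[\pi,3\pi/2],[3\pi/2,2\pi]$. *)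

theory Defs
  imports Complex_Main
begin

text \<open>Configurations (x, y, phi); unit turning radius.\<close>
type_synonym config = "real \<times> real \<times> real"

datatype seg = SegL | SegR | SegS

fun move :: "seg \<Rightarrow> real \<Rightarrow> config \<Rightarrow> config" where
  "move SegL s (x, y, \<phi>) = (x + sin (\<phi> + s) - sin \<phi>, y - cos (\<phi> + s) + cos \<phi>, \<phi> + s)"
| "move SegR s (x, y, \<phi>) = (x - sin (\<phi> - s) + sin \<phi>, y + cos (\<phi> - s) - cos \<phi>, \<phi> - s)"
| "move SegS s (x, y, \<phi>) = (x + s * cos \<phi>, y + s * sin \<phi>, \<phi>)"

datatype dtype = LSL | RSR | LSR | RSL | RLR | LRL

fun segs :: "dtype \<Rightarrow> seg \<times> seg \<times> seg" where
  "segs LSL = (SegL, SegS, SegL)"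
| "segs RSR = (SegR, SegS, SegR)"
| "segs LSR = (SegL, SegS, SegR)"
| "segs RSL = (SegR, SegS, SegL)"
| "segs RLR = (SegR, SegL, SegR)"
| "segs LRL = (SegL, SegR, SegL)"

definition seg_len_ok :: "seg \<Rightarrow> real \<Rightarrow> bool" where
  "seg_len_ok s l \<longleftrightarrow> 0 \<le> l \<and> (s \<noteq> SegS \<longrightarrow> l < 2 * pi)"

definition endpoint :: "dtype \<Rightarrow> real \<Rightarrow> real \<Rightarrow> real \<Rightarrow> real \<Rightarrow> config" where
  "endpoint w \<alpha> t p q =
     (case segs w of (a, b, c) \<Rightarrow> move c q (move b p (move a t (0, 0, \<alpha>))))"

definition dubins_path :: "dtype \<Rightarrow> real \<Rightarrow> real \<Rightarrow> real \<Rightarrow> real \<Rightarrow> real \<Rightarrow> real \<Rightarrow> bool" where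
  "dubins_path w \<alpha> d \<beta> t p q \<longleftrightarrow>
     (case segs w of (a, b, c) \<Rightarrow> seg_len_ok a t \<and> seg_len_ok b p \<and> seg_len_ok c q) \<and>
     (case endpoint w \<alpha> t p q of (x, y, \<phi>) \<Rightarrow>
        x = d \<and> y = 0 \<and> (\<exists>k::int. \<phi> = \<beta> + 2 * pi * of_int k))"

text \<open>The path of type w of the standard Dubins construction: for RLR and LRL the middle
  arc has length in [pi, 2 pi).\<close>
definition std_path :: "dtype \<Rightarrow> real \<Rightarrow> real \<Rightarrow> real \<Rightarrow> real \<times> real \<times> real \<Rightarrow> bool" where
  "std_path w \<alpha> d \<beta> x \<longleftrightarrow>
     (case x of (t, p, q) \<Rightarrow> dubins_path w \<alpha> d \<beta> t p q \<and> (w \<in> {RLR, LRL} \<longrightarrow> pi \<le> p))"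

definition seglens :: "dtype \<Rightarrow> real \<Rightarrow> real \<Rightarrow> real \<Rightarrow> real \<times> real \<times> real" where
  "seglens w \<alpha> d \<beta> = (THE x. std_path w \<alpha> d \<beta> x)"

definition tlen :: "dtype \<Rightarrow> real \<Rightarrow> real \<Rightarrow> real \<Rightarrow> real" where
  "tlen w \<alpha> d \<beta> = fst (seglens w \<alpha> d \<beta>)"
definition plen :: "dtype \<Rightarrow> real \<Rightarrow> real \<Rightarrow> real \<Rightarrow> real" where
  "plen w \<alpha> d \<beta> = fst (snd (seglens w \<alpha> d \<beta>))"
definition qlen :: "dtype \<Rightarrow> real \<Rightarrow> real \<Rightarrow> real \<Rightarrow> real" where
  "qlen w \<alpha> d \<beta> = snd (snd (seglens w \<alpha> d \<beta>))"

definition shortest_is :: "dtype \<Rightarrow> real \<Rightarrow> real \<Rightarrow> real \<Rightarrow> bool" where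
  "shortest_is w \<alpha> d \<beta> \<longleftrightarrow>
     (\<exists>t p q. dubins_path w \<alpha> d \<beta> t p q \<and>
        (\<forall>w' t' p' q'. dubins_path w' \<alpha> d \<beta> t' p' q' \<longrightarrow> t + p + q \<le> t' + p' + q'))"

definition ucircle :: "real \<times> real \<Rightarrow> (real \<times> real) set" where
  "ucircle c = {z. (fst z - fst c)\<^sup>2 + (snd z - snd c)\<^sup>2 = 1}"

definition C_il :: "real \<Rightarrow> (real \<times> real) set" where
  "C_il \<alpha> = ucircle (- sin \<alpha>, cos \<alpha>)"
definition C_ir :: "real \<Rightarrow> (real \<times> real) set" where
  "C_ir \<alpha> = ucircle (sin \<alpha>, - cos \<alpha>)"
definition C_fl :: "real \<Rightarrow> real \<Rightarrow> (real \<times> real) set" where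
  "C_fl d \<beta> = ucircle (d - sin \<beta>, cos \<beta>)"
definition C_fr :: "real \<Rightarrow> real \<Rightarrow> (real \<times> real) set" where
  "C_fr d \<beta> = ucircle (d + sin \<beta>, - cos \<beta>)"

end

theory Submission
  imports Defs
begin

text \<open>Write \<open>u = (\<beta> - \<alpha>) / 2\<close>, let \<open>4 sin a\<close> be the distance and \<open>\<theta>\<close> the direction from the centre of
  \<open>C_ir\<close> to that of \<open>C_fr\<close>, and let \<open>4 sin b\<close>, \<open>\<psi>\<close> be the same data for \<open>C_il\<close>, \<open>C_fl\<close>.  The arcs of
  RSR, RLR, LSL and LRL are then linear in these angles up to multiples of \<open>2 \<pi>\<close>.  In class
  \<open>a_12\<close> a short path forces \<open>C_ir\<close> and \<open>C_fl\<close> to meet, which removes RSL (up to a path with empty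
  straight part), fixes the multiples of \<open>2 \<pi>\<close>, and gives \<open>|a - b| \<le> u\<close>.  The lengths become
  \<open>4\<pi> - 4a - 2u\<close> for RLR, \<open>2\<pi> + 2u + 4 sin b\<close> for LSL, and \<open>4\<pi> - 4b + 2u\<close> for LRL, the last one
  dropping by \<open>2\<pi>\<close> as soon as \<open>C_il\<close> meets \<open>C_fr\<close>.  The condition \<open>t_rsr < \<pi>\<close> means \<open>\<theta> \<le> \<alpha>\<close>; then RSR
  has length \<open>2\<pi> - 2u + 4 sin a\<close> and LSR is longer, while for \<open>\<theta> > \<alpha>\<close> RSR gains a full turn
  and LSR, with \<open>t \<le> \<pi>/2\<close> and \<open>q = t - 2u + 2\<pi>\<close>, takes over its role.

  One degenerate case needs care: if \<open>C_ir\<close> and \<open>C_fl\<close> are tangent, the RLR path with short middle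
  arc \<open>2a\<close> may have an empty last arc and beat the standard RLR path.  In that case
  \<open>a \<ge> 5\<pi>/12\<close>, so that \<open>S\<^sub>1, S\<^sub>2 \<le> 0\<close> and RLR is the predicted type anyway.\<close>

section \<open>Circles, arcs and the six path types\<close>

lemma sq_dist_le_4_of_ucircle_meet:
  assumes "z \<in> ucircle (x1, y1)" "z \<in> ucircle (x2, y2)"
  shows "(x1 - x2)\<^sup>2 + (y1 - y2)\<^sup>2 \<le> 4"
proof -
  obtain x y where z: "z = (x, y)" by (cases z)
  have e: "(x - x1)\<^sup>2 + (y - y1)\<^sup>2 = 1" "(x - x2)\<^sup>2 + (y - y2)\<^sup>2 = 1"
    using assms by (auto simp: ucircle_def z)
  \<comment> \<open>Parallelogram law for the two radius vectors at the common point.\<close>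
  have "(x1 - x2)\<^sup>2 + (y1 - y2)\<^sup>2 + (2 * x - x1 - x2)\<^sup>2 + (2 * y - y1 - y2)\<^sup>2
      = 2 * ((x - x1)\<^sup>2 + (y - y1)\<^sup>2) + 2 * ((x - x2)\<^sup>2 + (y - y2)\<^sup>2)"
    by (simp add: power2_eq_square algebra_simps)
  then show ?thesis using e by (smt (verit) zero_le_power2)
qed

text \<open>The common point is the midpoint of the centres displaced at right angles to the line of
  centres. Pythagoras fixes \<open>k\<close>: \<open>s / 4 + k\<^sup>2 * s\<close> must be
  1.\<close>

lemma ucircle_meet_of_sq_dist_le_4:
  assumes "(x1 - x2)\<^sup>2 + (y1 - y2)\<^sup>2 \<le> 4"
  shows "ucircle (x1, y1) \<inter> ucircle (x2, y2) \<noteq> {}"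
proof (cases "x1 = x2 \<and> y1 = y2")
  case True
  then have "(x1 + 1, y1) \<in> ucircle (x1, y1) \<inter> ucircle (x2, y2)"
    by (simp add: ucircle_def)
  then show ?thesis by blast
next
  case False
  define s where "s = (x1 - x2)\<^sup>2 + (y1 - y2)\<^sup>2"
  define k where "k = sqrt ((1 - s / 4) / s)"
  have s: "s > 0" using False unfolding s_def by (simp add: sum_power2_gt_zero_iff)
  have "k\<^sup>2 = (1 - s / 4) / s" unfolding k_def using s assms by (simp add: s_def)
  then have k: "k\<^sup>2 * s = 1 - s / 4" using s by simp
  let ?x = "(x1 + x2) / 2 + k * (y1 - y2)" and ?y = "(y1 + y2) / 2 - k * (x1 - x2)"
  have "(?x - x1)\<^sup>2 + (?y - y1)\<^sup>2 = s / 4 + k\<^sup>2 * s" "(?x - x2)\<^sup>2 + (?y - y2)\<^sup>2 = s / 4 + k\<^sup>2 * s"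
    unfolding s_def by (simp_all add: power2_eq_square field_simps)
  then have "(?x, ?y) \<in> ucircle (x1, y1) \<inter> ucircle (x2, y2)"
    using k by (simp add: ucircle_def)
  then show ?thesis by blast
qed

lemma ucircle_meet_iff:
  "ucircle (x1, y1) \<inter> ucircle (x2, y2) \<noteq> {} \<longleftrightarrow> (x1 - x2)\<^sup>2 + (y1 - y2)\<^sup>2 \<le> 4"
  using sq_dist_le_4_of_ucircle_meet ucircle_meet_of_sq_dist_le_4 by blast

section \<open>Angle bounds from sines, and angles modulo full turns\<close>

lemma sin_ge_imp_between:
  fixes a x :: real
  assumes "0 < a" "a \<le> pi / 2" "- pi \<le> x" "x \<le> 2 * pi" "sin a \<le> sin x"
  shows "a \<le> x" "x \<le> pi - a"
proof -
  have "0 < sin a" using assms pi_gt_zero by (intro sin_gt_zero) linarith+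
  then have sx: "0 < sin x" using assms by simp
  have "0 < x"
  proof (rule ccontr)
    assume "\<not> 0 < x"
    then have "0 \<le> sin (- x)" using assms by (intro sin_ge_zero) auto
    then show False using sx by simp
  qed
  moreover have "x < pi"
  proof (rule ccontr)
    assume "\<not> x < pi"
    then have "sin x \<le> 0" using assms by (cases "x = 2 * pi") (auto intro!: sin_le_zero)
    then show False using sx by simp
  qed
  ultimately show "a \<le> x" "x \<le> pi - a"
    using sin_monotone_2pi[of x a] sin_monotone_2pi[of "pi - x" a] assms pi_gt_zero
    by (auto simp: not_less[symmetric] simp del: not_less)
qed

lemma sin_ge_of_between:
  fixes a x :: real
  assumes "0 \<le> a" "a \<le> pi / 2" "a \<le> x" "x \<le> pi - a"
  shows "sin a \<le> sin x"
proof (cases "x \<le> pi / 2")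
  case True
  then show ?thesis using assms by (intro sin_monotone_2pi_le) auto
next
  case False
  then have "sin a \<le> sin (pi - x)" using assms by (intro sin_monotone_2pi_le) auto
  then show ?thesis by simp
qed

lemma polar_unique:
  fixes r s x y :: real
  assumes "0 \<le> r" "0 < s" "r * cos x = s * cos y" "r * sin x = s * sin y"
  obtains k :: int where "r = s" "x = y + 2 * pi * of_int k"
proof -
  have "(r * cos x)\<^sup>2 + (r * sin x)\<^sup>2 = (s * cos y)\<^sup>2 + (s * sin y)\<^sup>2" using assms by simp
  then have "r\<^sup>2 * ((sin x)\<^sup>2 + (cos x)\<^sup>2) = s\<^sup>2 * ((sin y)\<^sup>2 + (cos y)\<^sup>2)"
    unfolding power_mult_distrib distrib_left by linarith
  then have rs: "r = s" using assms by (simp add: power2_eq_iff)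
  then have "sin x = sin y \<and> cos x = cos y" using assms by simp
  then show thesis using rs sin_cos_eq_iff[of x y] that by auto
qed

text \<open>An arc length lies in [0, 2 pi), so the window containing a congruent angle
  \<open>x\<close> fixes the number of full turns. Arc lengths are read off from angles in this way
  below.\<close>

lemma arc_eq:
  fixes t x :: real and m :: int
  assumes "t = x + 2 * pi * of_int m" "0 \<le> t" "t < 2 * pi"
  shows "0 \<le> x \<Longrightarrow> x < 2 * pi \<Longrightarrow> t = x"
    and "- (2 * pi) \<le> x \<Longrightarrow> x < 0 \<Longrightarrow> t = x + 2 * pi"
    and "2 * pi \<le> x \<Longrightarrow> x < 4 * pi \<Longrightarrow> t = x - 2 * pi"
proof -
  show "t = x" if "0 \<le> x" "x < 2 * pi"
  proof -
    have "0 < 2 * pi * (of_int m - (-1))" "0 < 2 * pi * (1 - of_int m)"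
      unfolding right_diff_distrib using assms that by linarith+
    then have "-1 < m" "m < 1" by (simp_all add: zero_less_mult_iff mult_less_0_iff)
    then have "m = 0" by linarith
    then show ?thesis using assms by simp
  qed
  show "t = x + 2 * pi" if "- (2 * pi) \<le> x" "x < 0"
  proof -
    have "0 < 2 * pi * (of_int m - (0))" "0 < 2 * pi * (2 - of_int m)"
      unfolding right_diff_distrib using assms that by linarith+
    then have "0 < m" "m < 2" by (simp_all add: zero_less_mult_iff mult_less_0_iff)
    then have "m = 1" by linarith
    then show ?thesis using assms by simp
  qed
  show "t = x - 2 * pi" if "2 * pi \<le> x" "x < 4 * pi"
  proof -
    have "0 < 2 * pi * (of_int m - (-2))" "0 < 2 * pi * (0 - of_int m)"
      unfolding right_diff_distrib using assms that by linarith+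
    then have "-2 < m" "m < 0" by (simp_all add: zero_less_mult_iff mult_less_0_iff)
    then have "m = -1" by linarith
    then show ?thesis using assms by simp
  qed
qed

lemma sin_abs_diff_le: "\<bar>sin x - sin y\<bar> \<le> \<bar>x - y\<bar>" for x y :: real
proof -
  have "\<bar>sin x - sin y\<bar> = 2 * \<bar>sin ((x - y) / 2)\<bar> * \<bar>cos ((x + y) / 2)\<bar>"
    by (simp add: sin_diff_sin abs_mult)
  also have "\<dots> \<le> 2 * \<bar>(x - y) / 2\<bar> * 1"
    by (intro mult_mono mult_left_mono abs_sin_x_le_abs_x) auto
  finally show ?thesis by simp
qed

section \<open>Endpoint equations as vectors between circle centres\<close>

lemma dubins_RLR_iff:
  "dubins_path RLR \<alpha> d \<beta> t p q \<longleftrightarrow>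
    0 \<le> t \<and> t < 2 * pi \<and> 0 \<le> p \<and> p < 2 * pi \<and> 0 \<le> q \<and> q < 2 * pi \<and>
    4 * sin (p / 2) * cos (\<alpha> - t + p / 2) = d + sin \<beta> - sin \<alpha> \<and>
    4 * sin (p / 2) * sin (\<alpha> - t + p / 2) = cos \<alpha> - cos \<beta> \<and>
    (\<exists>k::int. \<alpha> - t + p - q = \<beta> + 2 * pi * of_int k)"
proof -
  \<comment> \<open>The centres of the outer circles lie at distance 2 from the centre of the middle
    circle and are seen from it under the angle \<open>p\<close>: a chord of length
    \<open>4 * sin (p / 2)\<close>.\<close>
  have s: "2 * sin (\<alpha> - t + p) - 2 * sin (\<alpha> - t) = 4 * sin (p / 2) * cos (\<alpha> - t + p / 2)"
    using sin_diff_sin[of "\<alpha> - t + p" "\<alpha> - t"] by (simp add: field_simps)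
  have c: "2 * cos (\<alpha> - t) - 2 * cos (\<alpha> - t + p) = 4 * sin (p / 2) * sin (\<alpha> - t + p / 2)"
    using cos_diff_cos[of "\<alpha> - t" "\<alpha> - t + p"] by (simp add: field_simps)
  have "sin (\<alpha> - t + p - q) = sin \<beta> \<and> cos (\<alpha> - t + p - q) = cos \<beta>"
    if "\<exists>k::int. \<alpha> - t + p - q = \<beta> + 2 * pi * of_int k"
    using that by (simp add: sin_cos_eq_iff)
  then show ?thesis
    unfolding dubins_path_def endpoint_def s[symmetric] c[symmetric]
    by (auto simp: seg_len_ok_def)
qed

lemma dubins_LRL_iff:
  "dubins_path LRL \<alpha> d \<beta> t p q \<longleftrightarrow>
    0 \<le> t \<and> t < 2 * pi \<and> 0 \<le> p \<and> p < 2 * pi \<and> 0 \<le> q \<and> q < 2 * pi \<and>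
    4 * sin (p / 2) * cos (\<alpha> + t - p / 2) = d - sin \<beta> + sin \<alpha> \<and>
    4 * sin (p / 2) * sin (\<alpha> + t - p / 2) = cos \<beta> - cos \<alpha> \<and>
    (\<exists>k::int. \<alpha> + t - p + q = \<beta> + 2 * pi * of_int k)"
proof -
  have s: "2 * sin (\<alpha> + t) - 2 * sin (\<alpha> + t - p) = 4 * sin (p / 2) * cos (\<alpha> + t - p / 2)"
    using sin_diff_sin[of "\<alpha> + t" "\<alpha> + t - p"] by (simp add: field_simps)
  have c: "2 * cos (\<alpha> + t - p) - 2 * cos (\<alpha> + t) = 4 * sin (p / 2) * sin (\<alpha> + t - p / 2)"
    using cos_diff_cos[of "\<alpha> + t - p" "\<alpha> + t"] by (simp add: field_simps)
  have "sin (\<alpha> + t - p + q) = sin \<beta> \<and> cos (\<alpha> + t - p + q) = cos \<beta>"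
    if "\<exists>k::int. \<alpha> + t - p + q = \<beta> + 2 * pi * of_int k"
    using that by (simp add: sin_cos_eq_iff)
  then show ?thesis
    unfolding dubins_path_def endpoint_def s[symmetric] c[symmetric]
    by (auto simp: seg_len_ok_def)
qed

lemma dubins_RSR_iff:
  "dubins_path RSR \<alpha> d \<beta> t p q \<longleftrightarrow>
    0 \<le> t \<and> t < 2 * pi \<and> 0 \<le> p \<and> 0 \<le> q \<and> q < 2 * pi \<and>
    p * cos (\<alpha> - t) = d + sin \<beta> - sin \<alpha> \<and> p * sin (\<alpha> - t) = cos \<alpha> - cos \<beta> \<and>
    (\<exists>k::int. \<alpha> - t - q = \<beta> + 2 * pi * of_int k)"
proof -
  have "sin (\<alpha> - t - q) = sin \<beta> \<and> cos (\<alpha> - t - q) = cos \<beta>"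
    if "\<exists>k::int. \<alpha> - t - q = \<beta> + 2 * pi * of_int k"
    using that by (simp add: sin_cos_eq_iff)
  then show ?thesis
    unfolding dubins_path_def endpoint_def by (auto simp: seg_len_ok_def)
qed

lemma dubins_LSL_iff:
  "dubins_path LSL \<alpha> d \<beta> t p q \<longleftrightarrow>
    0 \<le> t \<and> t < 2 * pi \<and> 0 \<le> p \<and> 0 \<le> q \<and> q < 2 * pi \<and>
    p * cos (\<alpha> + t) = d - sin \<beta> + sin \<alpha> \<and> p * sin (\<alpha> + t) = cos \<beta> - cos \<alpha> \<and>
    (\<exists>k::int. \<alpha> + t + q = \<beta> + 2 * pi * of_int k)"
proof -
  have "sin (\<alpha> + t + q) = sin \<beta> \<and> cos (\<alpha> + t + q) = cos \<beta>"
    if "\<exists>k::int. \<alpha> + t + q = \<beta> + 2 * pi * of_int k"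
    using that by (simp add: sin_cos_eq_iff)
  then show ?thesis
    unfolding dubins_path_def endpoint_def by (auto simp: seg_len_ok_def)
qed

text \<open>The vector from the centre of \<open>C_il\<close> to that of \<open>C_fr\<close> has
  component \<open>p\<close> along the heading of the straight segment and component 2 to its
  right.\<close>

lemma dubins_LSR_iff:
  "dubins_path LSR \<alpha> d \<beta> t p q \<longleftrightarrow>
    0 \<le> t \<and> t < 2 * pi \<and> 0 \<le> p \<and> 0 \<le> q \<and> q < 2 * pi \<and>
    p * cos (\<alpha> + t) + 2 * sin (\<alpha> + t) = d + sin \<beta> + sin \<alpha> \<and>
    p * sin (\<alpha> + t) - 2 * cos (\<alpha> + t) = - cos \<alpha> - cos \<beta> \<and>
    (\<exists>k::int. \<alpha> + t - q = \<beta> + 2 * pi * of_int k)"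
proof -
  have "sin (\<alpha> + t - q) = sin \<beta> \<and> cos (\<alpha> + t - q) = cos \<beta>"
    if "\<exists>k::int. \<alpha> + t - q = \<beta> + 2 * pi * of_int k"
    using that by (simp add: sin_cos_eq_iff)
  then show ?thesis
    unfolding dubins_path_def endpoint_def by (auto simp: seg_len_ok_def)
qed

lemma dubins_RSL_imp:
  assumes "dubins_path RSL \<alpha> d \<beta> t p q"
  shows "p * cos (\<alpha> - t) - 2 * sin (\<alpha> - t) = d - sin \<beta> - sin \<alpha>"
    and "p * sin (\<alpha> - t) + 2 * cos (\<alpha> - t) = cos \<alpha> + cos \<beta>" and "0 \<le> p"
proof -
  have "sin (\<alpha> - t + q) = sin \<beta> \<and> cos (\<alpha> - t + q) = cos \<beta>"
    using assms unfolding dubins_path_def endpoint_def by (auto simp: sin_cos_eq_iff)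
  then show "p * cos (\<alpha> - t) - 2 * sin (\<alpha> - t) = d - sin \<beta> - sin \<alpha>"
    and "p * sin (\<alpha> - t) + 2 * cos (\<alpha> - t) = cos \<alpha> + cos \<beta>" and "0 \<le> p"
    using assms unfolding dubins_path_def endpoint_def by (auto simp: seg_len_ok_def)
qed

text \<open>A path with an empty segment also has another type. This moves degenerate paths to a
  type whose lengths are under control.\<close>

lemma dubins_path_drop_empty:
  "dubins_path RLR \<alpha> d \<beta> 0 p q \<Longrightarrow> dubins_path LRL \<alpha> d \<beta> p q 0"
  "dubins_path RLR \<alpha> d \<beta> t p 0 \<Longrightarrow> dubins_path LRL \<alpha> d \<beta> 0 t p"
  "dubins_path LRL \<alpha> d \<beta> 0 p q \<Longrightarrow> dubins_path RLR \<alpha> d \<beta> p q 0"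
  "dubins_path RSL \<alpha> d \<beta> t 0 q \<Longrightarrow> dubins_path LRL \<alpha> d \<beta> 0 t q"
  "dubins_path LSR \<alpha> d \<beta> t 0 q \<Longrightarrow> dubins_path LRL \<alpha> d \<beta> t q 0"
  "dubins_path LSR \<alpha> d \<beta> 0 p q \<Longrightarrow> dubins_path RSR \<alpha> d \<beta> 0 p q"
  by (auto simp: dubins_path_def endpoint_def seg_len_ok_def)

section \<open>Geometry of the short path case\<close>

lemma polar_sq:
  fixes r x X Y :: real
  assumes "r * cos x = X" "r * sin x = Y"
  shows "r\<^sup>2 = X\<^sup>2 + Y\<^sup>2"
proof -
  have "X\<^sup>2 + Y\<^sup>2 = r\<^sup>2 * ((sin x)\<^sup>2 + (cos x)\<^sup>2)"
    unfolding assms[symmetric] power_mult_distrib distrib_left by linarith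
  then show ?thesis by simp
qed

lemma polar_sin_diff:
  fixes r x y X Y :: real
  assumes "r * cos x = X" "r * sin x = Y"
  shows "r * sin (y - x) = sin y * X - cos y * Y"
  unfolding assms[symmetric] sin_diff by (simp add: algebra_simps)

text \<open>The map \<open>x \<mapsto> a\<close> with \<open>16 sin\<^sup>2 a = r\<^sup>2 + 4 + 4 r sin x\<close> is Lipschitz with constant \<open>1/2\<close> for
  \<open>r \<le> 2\<close>; here \<open>(X, Y) = (r cos x, r sin x)\<close> and the argument moves from \<open>x\<close> to \<open>x + w\<close>.\<close>

lemma half_lipschitz:
  fixes X Y a b w :: real
  assumes r: "X\<^sup>2 + Y\<^sup>2 \<le> 4" and w: "0 \<le> w" "w \<le> pi"
    and a: "0 \<le> a" "a \<le> pi / 2" "16 * (sin a)\<^sup>2 = X\<^sup>2 + Y\<^sup>2 + 4 + 4 * Y"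
    and b: "0 \<le> b" "b \<le> pi / 2" "16 * (sin b)\<^sup>2 = X\<^sup>2 + Y\<^sup>2 + 4 + 4 * (Y * cos w + X * sin w)"
  shows "b \<le> a + w / 2"
proof (cases "2 * a + w \<le> pi")
  case False
  then show ?thesis using b by simp
next
  case True
  define K where "K = 4 - (X\<^sup>2 + Y\<^sup>2)"
  have K: "0 \<le> K" using r by (simp add: K_def)
  have ca: "8 * cos (2 * a) = K - 4 * Y" using a unfolding cos_double_sin K_def by simp
  have cb: "8 * cos (2 * b) = K - 4 * (Y * cos w + X * sin w)"
    using b unfolding cos_double_sin K_def by simp
  have Y2: "Y\<^sup>2 \<le> 4" using r by (smt (verit) zero_le_power2)
  then have Y: "-2 \<le> Y" using abs_le_square_iff[of Y 2] by simp
  \<comment> \<open>\<open>16 - K + 8 * Y\<close> equals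
    \<open>X\<^sup>2 + (Y + 2) * (Y + 6)\<close>, and its product with \<open>K\<close> equals
    \<open>64 - (K - 4 * Y)\<^sup>2 - 16 * X\<^sup>2\<close>. Nonnegativity of this product is what
    bounds \<open>X\<close> by \<open>2 * sin (2 * a)\<close>.\<close>
  have "0 \<le> (Y + 2) * (Y + 6)" using Y by simp
  then have "0 \<le> 16 - K + 8 * Y" unfolding K_def power2_eq_square
    using zero_le_square[of X] by (simp add: algebra_simps)
  then have "0 \<le> K * (16 - K + 8 * Y)" using K by simp
  moreover have "64 * (sin (2 * a))\<^sup>2 = 64 - (8 * cos (2 * a))\<^sup>2"
    unfolding sin_squared_eq by (simp add: power_mult_distrib)
  ultimately have "64 * (sin (2 * a))\<^sup>2 \<ge> 16 * X\<^sup>2"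
    unfolding ca by (simp add: K_def power2_eq_square algebra_simps)
  then have "X\<^sup>2 \<le> (2 * sin (2 * a))\<^sup>2" by (simp add: power_mult_distrib)
  moreover have "0 \<le> sin (2 * a)" using a by (intro sin_ge_zero) auto
  ultimately have "X \<le> 2 * sin (2 * a)" using power2_le_imp_le[of X "2 * sin (2 * a)"] by simp
  then have "0 \<le> (2 * sin (2 * a) - X) * sin w" using w by (intro mult_nonneg_nonneg sin_ge_zero) auto
  moreover have "0 \<le> K * (1 - cos w)" using K by simp
  \<comment> \<open>Both terms on the right are nonnegative, so the cosines compare; the case
    distinction keeps \<open>2 * a + w\<close> in [0, pi], where cosine is decreasing.\<close>
  moreover have "8 * cos (2 * b) - 8 * cos (2 * a + w) = K * (1 - cos w) + 4 * ((2 * sin (2 * a) - X) * sin w)"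
  proof -
    have "8 * cos (2 * a + w) = (8 * cos (2 * a)) * cos w - 8 * sin (2 * a) * sin w"
      by (simp add: cos_add)
    then show ?thesis unfolding ca cb by (simp add: algebra_simps)
  qed
  ultimately have "cos (2 * a + w) \<le> cos (2 * b)" by linarith
  then have "2 * b \<le> 2 * a + w"
    using cos_mono_le_eq[of "2 * a + w" "2 * b"] a b w True by simp
  then show ?thesis by simp
qed

text \<open>The hypothesis is a law of cosines with \<open>z\<close> a squared centre distance. Its
  left side factors as \<open>16 * sin x * (sin y - sin x)\<close>, so the meeting of two circles
  becomes a comparison of sines.\<close>

lemma chord_cmp:
  fixes x y z :: real
  assumes "4 * (4 * sin x * sin y) - (4 * sin x)\<^sup>2 = 4 - z" "0 < sin x"
  shows "z \<le> 4 \<longleftrightarrow> sin x \<le> sin y"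
proof -
  have "4 - z = 16 * sin x * (sin y - sin x)"
    using assms(1) by (simp add: power2_eq_square algebra_simps)
  moreover have "0 \<le> 16 * sin x * (sin y - sin x) \<longleftrightarrow> sin x \<le> sin y"
    using assms(2) by (simp add: zero_le_mult_iff)
  ultimately show ?thesis by linarith
qed

lemma quadrant_signs:
  fixes \<alpha> \<beta> :: real
  assumes "0 \<le> \<alpha>" "\<alpha> \<le> pi / 2" "pi / 2 \<le> \<beta>" "\<beta> \<le> pi"
  shows "0 \<le> sin \<alpha>" "0 \<le> cos \<alpha>" "0 \<le> sin \<beta>" "cos \<beta> \<le> 0"
proof -
  show "cos \<beta> \<le> 0" using cos_ge_zero[of "pi - \<beta>"] assms by simp
qed (use assms in \<open>auto intro!: sin_ge_zero cos_ge_zero\<close>)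

text \<open>In this class \<open>cos \<alpha> - cos \<beta>\<close> is nonnegative, which puts
  \<open>\<theta>\<close> in the upper and \<open>\<psi>\<close> in the lower half plane. The bounds
  on \<open>a\<close> and \<open>b\<close> say that the centre distances are positive and at most 4;
  \<open>rl\<close> says that \<open>C_ir\<close> and \<open>C_fl\<close> meet.\<close>

locale short_a12 =
  fixes \<alpha> \<beta> d \<theta> \<psi> a b :: real
  assumes d_pos: "0 < d"
    and ab: "0 \<le> \<alpha>" "\<alpha> \<le> pi / 2" "pi / 2 \<le> \<beta>" "\<beta> \<le> pi"
    and \<theta>: "0 \<le> \<theta>" "\<theta> \<le> pi" and \<psi>: "- pi \<le> \<psi>" "\<psi> \<le> 0"
    and a: "0 < a" "a \<le> pi / 2" and b: "0 < b" "b \<le> pi / 2"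
    and rr: "4 * sin a * cos \<theta> = d + sin \<beta> - sin \<alpha>" "4 * sin a * sin \<theta> = cos \<alpha> - cos \<beta>"
    and ll: "4 * sin b * cos \<psi> = d - sin \<beta> + sin \<alpha>" "4 * sin b * sin \<psi> = cos \<beta> - cos \<alpha>"
    and rl: "(d - sin \<alpha> - sin \<beta>)\<^sup>2 + (cos \<alpha> + cos \<beta>)\<^sup>2 \<le> 4"
begin

text \<open>Disjointness of \<open>C_il\<close> and \<open>C_fr\<close>: it separates cases (i) and
  (ii) from case (iii).\<close>

definition far :: bool where
  "far \<longleftrightarrow> (d + sin \<alpha> + sin \<beta>)\<^sup>2 + (cos \<alpha> + cos \<beta>)\<^sup>2 > 4"

lemma unit: "(cos \<alpha>)\<^sup>2 = 1 - (sin \<alpha>)\<^sup>2" "(cos \<beta>)\<^sup>2 = 1 - (sin \<beta>)\<^sup>2"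
  by (simp_all add: cos_squared_eq)

lemma signs: "0 \<le> sin \<alpha>" "0 \<le> cos \<alpha>" "0 \<le> sin \<beta>" "cos \<beta> \<le> 0" "0 < sin a" "0 < sin b"
  using quadrant_signs[OF ab] a b by (auto intro!: sin_gt_zero)

section \<open>Triangles of circle centres and the resulting angle bounds\<close>

lemma rr_sq: "(4 * sin a)\<^sup>2 = (d + sin \<beta> - sin \<alpha>)\<^sup>2 + (cos \<alpha> - cos \<beta>)\<^sup>2"
  using polar_sq[OF rr] by simp

lemma ll_sq: "(4 * sin b)\<^sup>2 = (d - sin \<beta> + sin \<alpha>)\<^sup>2 + (cos \<beta> - cos \<alpha>)\<^sup>2"
  using polar_sq[OF ll] by simp

text \<open>Law of cosines in the triangle of the centres of \<open>C_ir\<close>,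
  \<open>C_fr\<close>, \<open>C_fl\<close>, the last two being 2 apart. The next three lemmas treat
  the other triangles formed by three of the four centres.\<close>

lemma sin_bt: "4 * (4 * sin a * sin (\<beta> - \<theta>)) - (4 * sin a)\<^sup>2
    = 4 - ((d - sin \<alpha> - sin \<beta>)\<^sup>2 + (cos \<alpha> + cos \<beta>)\<^sup>2)"
  unfolding polar_sin_diff[OF rr] rr_sq using unit by (simp add: power2_eq_square algebra_simps)

lemma sin_ta: "4 * (4 * sin a * sin (\<theta> - \<alpha>)) - (4 * sin a)\<^sup>2
    = 4 - ((d + sin \<alpha> + sin \<beta>)\<^sup>2 + (cos \<alpha> + cos \<beta>)\<^sup>2)"
proof -
  have "sin (\<theta> - \<alpha>) = - sin (\<alpha> - \<theta>)" using sin_minus[of "\<alpha> - \<theta>"] by simp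
  then have "4 * sin a * sin (\<theta> - \<alpha>) = - (4 * sin a * sin (\<alpha> - \<theta>))" by simp
  then show ?thesis
    unfolding polar_sin_diff[OF rr] rr_sq using unit by (simp add: power2_eq_square algebra_simps)
qed

lemma sin_ap: "4 * (4 * sin b * sin (\<alpha> - \<psi>)) - (4 * sin b)\<^sup>2
    = 4 - ((d - sin \<alpha> - sin \<beta>)\<^sup>2 + (cos \<alpha> + cos \<beta>)\<^sup>2)"
  unfolding polar_sin_diff[OF ll] ll_sq using unit by (simp add: power2_eq_square algebra_simps)

lemma sin_bp: "4 * (4 * sin b * sin (\<beta> - \<psi> - pi)) - (4 * sin b)\<^sup>2
    = 4 - ((d + sin \<alpha> + sin \<beta>)\<^sup>2 + (cos \<alpha> + cos \<beta>)\<^sup>2)"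
proof -
  have "sin (\<beta> - \<psi> - pi) = - sin (\<beta> - \<psi>)" by (simp add: sin_diff)
  then have "4 * sin b * sin (\<beta> - \<psi> - pi) = - (4 * sin b * sin (\<beta> - \<psi>))" by simp
  then show ?thesis
    unfolding polar_sin_diff[OF ll] ll_sq using unit by (simp add: power2_eq_square algebra_simps)
qed

lemma bt: "a \<le> \<beta> - \<theta>" "\<beta> - \<theta> \<le> pi - a"
proof -
  have "sin a \<le> sin (\<beta> - \<theta>)" using chord_cmp[OF sin_bt] rl signs by simp
  then show "a \<le> \<beta> - \<theta>" "\<beta> - \<theta> \<le> pi - a"
    using sin_ge_imp_between[of a "\<beta> - \<theta>"] a ab \<theta> pi_gt_zero by auto
qed

lemma ap: "b \<le> \<alpha> - \<psi>" "\<alpha> - \<psi> \<le> pi - b"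
proof -
  have "sin b \<le> sin (\<alpha> - \<psi>)" using chord_cmp[OF sin_ap] rl signs by simp
  then show "b \<le> \<alpha> - \<psi>" "\<alpha> - \<psi> \<le> pi - b"
    using sin_ge_imp_between[of b "\<alpha> - \<psi>"] b ab \<psi> pi_gt_zero by auto
qed

text \<open>If \<open>\<theta> - \<alpha>\<close> were at least \<open>a\<close>, then
  \<open>bt\<close> would keep it below \<open>pi - a\<close>, so its sine would be at least
  \<open>sin a\<close> and \<open>C_il\<close> would meet \<open>C_fr\<close>.\<close>

lemma ta_far: "far \<Longrightarrow> \<theta> - \<alpha> < a"
proof (rule ccontr)
  assume "far" "\<not> \<theta> - \<alpha> < a"
  then have "sin a \<le> sin (\<theta> - \<alpha>)" using bt ab a by (intro sin_ge_of_between) auto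
  then show False using chord_cmp[OF sin_ta] signs \<open>far\<close> by (simp add: far_def)
qed

lemma ta_near: "\<not> far \<Longrightarrow> a \<le> \<theta> - \<alpha>"
proof -
  assume "\<not> far"
  then have "sin a \<le> sin (\<theta> - \<alpha>)" using chord_cmp[OF sin_ta] signs by (simp add: far_def)
  then show ?thesis
    using sin_ge_imp_between[of a "\<theta> - \<alpha>"] a ab \<theta> pi_gt_zero by auto
qed

lemma bp_far: "far \<Longrightarrow> \<beta> - \<psi> - pi < b"
proof (rule ccontr)
  assume "far" "\<not> \<beta> - \<psi> - pi < b"
  then have "sin b \<le> sin (\<beta> - \<psi> - pi)" using ap ab b by (intro sin_ge_of_between) auto
  then show False using chord_cmp[OF sin_bp] signs \<open>far\<close> by (simp add: far_def)
qed

lemma bp_near: "\<not> far \<Longrightarrow> b \<le> \<beta> - \<psi> - pi"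
proof -
  assume "\<not> far"
  then have "sin b \<le> sin (\<beta> - \<psi> - pi)" using chord_cmp[OF sin_bp] signs by (simp add: far_def)
  then show ?thesis
    using sin_ge_imp_between[of b "\<beta> - \<psi> - pi"] b ab \<psi> pi_gt_zero by auto
qed

text \<open>Let \<open>(W, V)\<close> be the vector from the centre of \<open>C_ir\<close> to that
  of \<open>C_fl\<close>. Adding a vector of length 2 perpendicular to the final heading gives the
  vector behind \<open>a\<close>; using the initial heading gives the one behind \<open>b\<close>.
  The added vector turns by \<open>\<beta> - \<alpha>\<close>, and \<open>half_lipschitz\<close>
  bounds the effect.\<close>

lemma ab_diff: "b - a \<le> (\<beta> - \<alpha>) / 2" "a - b \<le> (\<beta> - \<alpha>) / 2"
proof -
  define W V where "W = d - sin \<alpha> - sin \<beta>" and "V = cos \<alpha> + cos \<beta>"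
  \<comment> \<open>\<open>Xa\<close> and \<open>Xb\<close> are oriented oppositely, so that
    rotation by the same angle \<open>\<beta> - \<alpha>\<close> takes \<open>Ya\<close> to
    \<open>Yb\<close> and also \<open>Yb\<close> to \<open>Ya\<close>.\<close>
  define Xa Ya where "Xa = - (cos \<beta> * W + sin \<beta> * V)" and "Ya = sin \<beta> * W - cos \<beta> * V"
  define Xb Yb where "Xb = cos \<alpha> * W + sin \<alpha> * V" and "Yb = sin \<alpha> * W - cos \<alpha> * V"
  have norm_rot: "(C * x + S * y)\<^sup>2 + (S * x - C * y)\<^sup>2 = (S\<^sup>2 + C\<^sup>2) * (x\<^sup>2 + y\<^sup>2)" for C S x y :: real
    by (simp add: power2_eq_square algebra_simps)
  have sq: "Xa\<^sup>2 + Ya\<^sup>2 = W\<^sup>2 + V\<^sup>2" "Xb\<^sup>2 + Yb\<^sup>2 = W\<^sup>2 + V\<^sup>2"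
    unfolding Xa_def Ya_def Xb_def Yb_def power2_minus norm_rot by simp_all
  have sa: "16 * (sin a)\<^sup>2 = W\<^sup>2 + V\<^sup>2 + 4 + 4 * Ya"
    using rr_sq unit unfolding W_def V_def Ya_def by algebra
  have sb: "16 * (sin b)\<^sup>2 = W\<^sup>2 + V\<^sup>2 + 4 + 4 * Yb"
    using ll_sq unit unfolding W_def V_def Yb_def by algebra
  have rot_rot: "(S * x - C * y) * (C * C' + S * S') - (C * x + S * y) * (S * C' - C * S') = S' * x - C' * y"
    if "S\<^sup>2 + C\<^sup>2 = 1" for C S C' S' x y :: real
    using that by algebra
  have rot: "Ya * cos (\<beta> - \<alpha>) + Xa * sin (\<beta> - \<alpha>) = Yb"
    unfolding Xa_def Ya_def Yb_def cos_diff sin_diff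
    using rot_rot[OF sin_cos_squared_add, of \<beta> W V "cos \<alpha>" "sin \<alpha>"] by algebra
  have rot': "Yb * cos (\<beta> - \<alpha>) + Xb * sin (\<beta> - \<alpha>) = Ya"
    unfolding Xb_def Ya_def Yb_def cos_diff sin_diff
    using rot_rot[OF sin_cos_squared_add, of \<alpha> W V "cos \<beta>" "sin \<beta>"] by algebra
  have r: "W\<^sup>2 + V\<^sup>2 \<le> 4" using rl unfolding W_def V_def .
  have "b \<le> a + (\<beta> - \<alpha>) / 2"
    by (rule half_lipschitz[of Xa Ya]) (use r sq sa sb a b ab in \<open>simp_all add: rot\<close>)
  then show "b - a \<le> (\<beta> - \<alpha>) / 2" by linarith
  have "a \<le> b + (\<beta> - \<alpha>) / 2"
    by (rule half_lipschitz[of Xb Yb]) (use r sq sa sb a b ab in \<open>simp_all add: rot'\<close>)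
  then show "a - b \<le> (\<beta> - \<alpha>) / 2" by linarith
qed

lemma sin_ab_diff: "\<bar>sin a - sin b\<bar> \<le> (\<beta> - \<alpha>) / 2"
  using sin_abs_diff_le[of a b] ab_diff by linarith

end

section \<open>Lengths of the paths without an inner tangent\<close>

lemma dubins_RLR_imp_RSL: "dubins_path RLR \<alpha> d \<beta> t p 0 \<Longrightarrow> dubins_path RSL \<alpha> d \<beta> t 0 p"
  by (auto simp: dubins_path_def endpoint_def seg_len_ok_def)

lemma middle_arc_cases:
  fixes p a :: real
  assumes "0 \<le> p" "p < 2 * pi" "0 < a" "a \<le> pi / 2" "sin (p / 2) = sin a"
  shows "p = 2 * a \<or> p = 2 * pi - 2 * a"
proof (cases "p / 2 \<le> pi / 2")
  case True
  then have "p / 2 = a"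
    using assms sin_inj_pi[of "p / 2" a] by simp
  then show ?thesis by simp
next
  case False
  then have "pi - p / 2 = a"
    using assms sin_inj_pi[of "pi - p / 2" a] by simp
  then show ?thesis by simp
qed

context short_a12
begin

section \<open>Possible arcs and lengths of RLR, LRL, RSR, LSL and RSL paths\<close>

lemma RLR_angles:
  assumes "dubins_path RLR \<alpha> d \<beta> t p q"
  obtains h and m n :: int where "p = 2 * h" "h = a \<or> h = pi - a"
    "t = \<alpha> - \<theta> + h + 2 * pi * of_int m" "q = \<theta> - \<beta> + h + 2 * pi * of_int n"
    "0 \<le> t" "t < 2 * pi" "0 \<le> q" "q < 2 * pi"
proof -
  have r: "0 \<le> t" "t < 2 * pi" "0 \<le> p" "p < 2 * pi" "0 \<le> q" "q < 2 * pi"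
    and e: "4 * sin (p / 2) * cos (\<alpha> - t + p / 2) = 4 * sin a * cos \<theta>"
      "4 * sin (p / 2) * sin (\<alpha> - t + p / 2) = 4 * sin a * sin \<theta>"
    and k: "\<exists>k::int. \<alpha> - t + p - q = \<beta> + 2 * pi * of_int k"
    using assms unfolding dubins_RLR_iff rr by auto
  obtain l :: int where l: "\<alpha> - t + p - q = \<beta> + 2 * pi * of_int l" using k by blast
  have "0 \<le> 4 * sin (p / 2)" using r by (simp add: sin_ge_zero)
  then obtain k :: int where k: "4 * sin (p / 2) = 4 * sin a" "\<alpha> - t + p / 2 = \<theta> + 2 * pi * of_int k"
    using polar_unique[OF _ _ e] signs by auto
  show thesis
  proof
    show "p = 2 * (p / 2)" by simp
    show "p / 2 = a \<or> p / 2 = pi - a" using middle_arc_cases[of p a] r a k by auto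
    show "t = \<alpha> - \<theta> + p / 2 + 2 * pi * of_int (- k)" using k by simp
    show "q = \<theta> - \<beta> + p / 2 + 2 * pi * of_int (k - l)"
      using k l by (simp add: algebra_simps)
  qed (use r in auto)
qed

lemma LRL_angles:
  assumes "dubins_path LRL \<alpha> d \<beta> t p q"
  obtains h and m n :: int where "p = 2 * h" "h = b \<or> h = pi - b"
    "t = \<psi> - \<alpha> + h + 2 * pi * of_int m" "q = \<beta> - \<psi> + h + 2 * pi * of_int n"
    "0 \<le> t" "t < 2 * pi" "0 \<le> q" "q < 2 * pi"
proof -
  have r: "0 \<le> t" "t < 2 * pi" "0 \<le> p" "p < 2 * pi" "0 \<le> q" "q < 2 * pi"
    and e: "4 * sin (p / 2) * cos (\<alpha> + t - p / 2) = 4 * sin b * cos \<psi>"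
      "4 * sin (p / 2) * sin (\<alpha> + t - p / 2) = 4 * sin b * sin \<psi>"
    and k: "\<exists>k::int. \<alpha> + t - p + q = \<beta> + 2 * pi * of_int k"
    using assms unfolding dubins_LRL_iff ll by auto
  obtain l :: int where l: "\<alpha> + t - p + q = \<beta> + 2 * pi * of_int l" using k by blast
  have "0 \<le> 4 * sin (p / 2)" using r by (simp add: sin_ge_zero)
  then obtain k :: int where k: "4 * sin (p / 2) = 4 * sin b" "\<alpha> + t - p / 2 = \<psi> + 2 * pi * of_int k"
    using polar_unique[OF _ _ e] signs by auto
  show thesis
  proof
    show "p = 2 * (p / 2)" by simp
    show "p / 2 = b \<or> p / 2 = pi - b" using middle_arc_cases[of p b] r b k by auto
    show "t = \<psi> - \<alpha> + p / 2 + 2 * pi * of_int k" using k by simp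
    show "q = \<beta> - \<psi> + p / 2 + 2 * pi * of_int (l - k)"
      using k l by (simp add: algebra_simps)
  qed (use r in auto)
qed

lemma RLR_long:
  assumes "dubins_path RLR \<alpha> d \<beta> t p q" "p = 2 * pi - 2 * a"
  shows "t = \<alpha> - \<theta> + pi - a" "q = \<theta> - \<beta> + pi - a"
proof -
  obtain h and m n :: int where h: "p = 2 * h" and *:
    "t = \<alpha> - \<theta> + h + 2 * pi * of_int m" "q = \<theta> - \<beta> + h + 2 * pi * of_int n"
    "0 \<le> t" "t < 2 * pi" "0 \<le> q" "q < 2 * pi"
    using RLR_angles[OF assms(1)] by metis
  have "h = pi - a" using h assms(2) by simp
  then show "t = \<alpha> - \<theta> + pi - a" "q = \<theta> - \<beta> + pi - a"
    using arc_eq(1)[OF *(1,3,4)] arc_eq(1)[OF *(2,5,6)] bt ab a \<theta> by auto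
qed

lemma RLR_long_exists:
  "dubins_path RLR \<alpha> d \<beta> (\<alpha> - \<theta> + pi - a) (2 * pi - 2 * a) (\<theta> - \<beta> + pi - a)"
proof -
  have h: "(2 * pi - 2 * a) / 2 = pi - a" by (simp add: diff_divide_distrib)
  have \<theta>': "\<alpha> - (\<alpha> - \<theta> + pi - a) + (pi - a) = \<theta>" by simp
  have "\<alpha> - (\<alpha> - \<theta> + pi - a) + (2 * pi - 2 * a) - (\<theta> - \<beta> + pi - a) = \<beta> + 2 * pi * of_int 0"
    by simp
  then have "\<exists>k::int. \<alpha> - (\<alpha> - \<theta> + pi - a) + (2 * pi - 2 * a) - (\<theta> - \<beta> + pi - a) = \<beta> + 2 * pi * of_int k"
    by blast
  then show ?thesis
    unfolding dubins_RLR_iff h \<theta>' using rr bt ab a \<theta> pi_gt_zero by auto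
qed

text \<open>By \<open>bt\<close>, \<open>\<theta> < \<beta>\<close>, so the last arc always gains a
  full turn. The first gains one only for \<open>\<theta> > \<alpha>\<close>, which is the jump
  between cases (i) and (ii).\<close>

lemma RSR_angles:
  assumes "dubins_path RSR \<alpha> d \<beta> t p q"
  shows "p = 4 * sin a" "t = (if \<theta> \<le> \<alpha> then \<alpha> - \<theta> else \<alpha> - \<theta> + 2 * pi)" "q = \<theta> - \<beta> + 2 * pi"
proof -
  have r: "0 \<le> t" "t < 2 * pi" "0 \<le> p" "0 \<le> q" "q < 2 * pi"
    and e: "p * cos (\<alpha> - t) = 4 * sin a * cos \<theta>" "p * sin (\<alpha> - t) = 4 * sin a * sin \<theta>"
    and k: "\<exists>k::int. \<alpha> - t - q = \<beta> + 2 * pi * of_int k"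
    using assms unfolding dubins_RSR_iff rr by auto
  obtain l :: int where l: "\<alpha> - t - q = \<beta> + 2 * pi * of_int l" using k by blast
  obtain k :: int where k: "p = 4 * sin a" "\<alpha> - t = \<theta> + 2 * pi * of_int k"
    using polar_unique[OF _ _ e] signs r by auto
  show "p = 4 * sin a" by fact
  have "t = \<alpha> - \<theta> + 2 * pi * of_int (- k)" "q = \<theta> - \<beta> + 2 * pi * of_int (k - l)"
    using k l by (auto simp: algebra_simps)
  then show "t = (if \<theta> \<le> \<alpha> then \<alpha> - \<theta> else \<alpha> - \<theta> + 2 * pi)" "q = \<theta> - \<beta> + 2 * pi"
    using arc_eq(1,2)[of t "\<alpha> - \<theta>" "- k"] arc_eq(2)[of q "\<theta> - \<beta>" "k - l"] r bt ab a \<theta> by auto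
qed

lemma RSR_exists:
  "dubins_path RSR \<alpha> d \<beta> (if \<theta> \<le> \<alpha> then \<alpha> - \<theta> else \<alpha> - \<theta> + 2 * pi) (4 * sin a) (\<theta> - \<beta> + 2 * pi)"
proof -
  let ?t = "if \<theta> \<le> \<alpha> then \<alpha> - \<theta> else \<alpha> - \<theta> + 2 * pi"
  have "\<alpha> - ?t = (if \<theta> \<le> \<alpha> then \<theta> else \<theta> - 2 * pi)" by simp
  then have "sin (\<alpha> - ?t) = sin \<theta>" "cos (\<alpha> - ?t) = cos \<theta>"
    by (simp_all add: sin_diff cos_diff)
  moreover have "\<alpha> - ?t - (\<theta> - \<beta> + 2 * pi) = \<beta> + 2 * pi * of_int (if \<theta> \<le> \<alpha> then - 1 else - 2)"
    by simp
  then have "\<exists>k::int. \<alpha> - ?t - (\<theta> - \<beta> + 2 * pi) = \<beta> + 2 * pi * of_int k" by blast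
  moreover have "0 \<le> ?t" "?t < 2 * pi" using bt ab a \<theta> by auto
  ultimately show ?thesis
    unfolding dubins_RSR_iff using rr signs bt ab a \<theta> by auto
qed

lemma LSL_length:
  assumes "dubins_path LSL \<alpha> d \<beta> t p q"
  shows "t + p + q = 2 * pi + (\<beta> - \<alpha>) + 4 * sin b"
proof -
  have r: "0 \<le> t" "t < 2 * pi" "0 \<le> p" "0 \<le> q" "q < 2 * pi"
    and e: "p * cos (\<alpha> + t) = 4 * sin b * cos \<psi>" "p * sin (\<alpha> + t) = 4 * sin b * sin \<psi>"
    and k: "\<exists>k::int. \<alpha> + t + q = \<beta> + 2 * pi * of_int k"
    using assms unfolding dubins_LSL_iff ll by auto
  obtain l :: int where l: "\<alpha> + t + q = \<beta> + 2 * pi * of_int l" using k by blast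
  obtain k :: int where k: "p = 4 * sin b" "\<alpha> + t = \<psi> + 2 * pi * of_int k"
    using polar_unique[OF _ _ e] signs r by auto
  have "t = \<psi> - \<alpha> + 2 * pi * of_int k" "q = \<beta> - \<psi> + 2 * pi * of_int (l - k)"
    using k l by (auto simp: algebra_simps)
  then show ?thesis
    using arc_eq(2)[of t "\<psi> - \<alpha>" k] arc_eq(1)[of q "\<beta> - \<psi>" "l - k"] r ap ab b \<psi> k by auto
qed

text \<open>An inner tangent segment of length \<open>p\<close> requires squared centre distance
  \<open>p\<^sup>2 + 4\<close>, while \<open>rl\<close> allows at most 4.\<close>

lemma RSL_imp_LRL:
  assumes "dubins_path RSL \<alpha> d \<beta> t p q"
  shows "p = 0" "dubins_path LRL \<alpha> d \<beta> 0 t q"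
proof -
  note e = dubins_RSL_imp[OF assms]
  have "(d - sin \<beta> - sin \<alpha>)\<^sup>2 + (cos \<alpha> + cos \<beta>)\<^sup>2 = p\<^sup>2 + 4"
    unfolding e(1,2)[symmetric] using sin_cos_squared_add[of "\<alpha> - t"] by algebra
  moreover have "d - sin \<beta> - sin \<alpha> = d - sin \<alpha> - sin \<beta>" by simp
  ultimately have "p\<^sup>2 \<le> 0" using rl by simp
  then show "p = 0" by simp
  then show "dubins_path LRL \<alpha> d \<beta> 0 t q" using assms dubins_path_drop_empty(4) by simp
qed

text \<open>With middle arc \<open>2 * a\<close> the last angle
  \<open>\<theta> - \<beta> + a\<close> is nonpositive by \<open>bt\<close>, so it gains a full turn
  unless it is 0. The last disjunct keeps this tangent case with all its data, since such a path can
  be shorter than the standard one.\<close>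

lemma RLR_length_far:
  assumes "far" "dubins_path RLR \<alpha> d \<beta> t p q"
  shows "t + p + q = 4 * pi - 4 * a - (\<beta> - \<alpha>) \<or> t + p + q = 2 * pi + 4 * a - (\<beta> - \<alpha>) \<or>
    (p = 2 * a \<and> q = 0 \<and> t = \<alpha> - \<theta> + a \<and> \<beta> - \<theta> = a)"
proof -
  obtain h and m n :: int where h: "p = 2 * h" "h = a \<or> h = pi - a" and *:
    "t = \<alpha> - \<theta> + h + 2 * pi * of_int m" "q = \<theta> - \<beta> + h + 2 * pi * of_int n"
    "0 \<le> t" "t < 2 * pi" "0 \<le> q" "q < 2 * pi"
    using RLR_angles[OF assms(2)] by metis
  show ?thesis
  proof (cases "h = a")
    case True
    then have "t = \<alpha> - \<theta> + a" using arc_eq(1)[OF *(1,3,4)] ta_far[OF assms(1)] ab a \<theta> by auto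
    moreover have "q = \<theta> - \<beta> + a + 2 * pi \<or> q = 0 \<and> \<beta> - \<theta> = a"
      using arc_eq(1,2)[OF *(2,5,6)] True bt ab a \<theta> pi_gt_zero by (smt (verit))
    ultimately show ?thesis using True h by auto
  next
    case False
    then show ?thesis using h RLR_long[OF assms(2)] by auto
  qed
qed

lemma RLR_length_near:
  assumes "\<not> far" "dubins_path RLR \<alpha> d \<beta> t p q"
  shows "t + p + q = 4 * pi - 4 * a - (\<beta> - \<alpha>) \<or> t + p + q = 4 * pi + 4 * a - (\<beta> - \<alpha>) \<or> t = 0 \<or> q = 0"
proof -
  obtain h and m n :: int where h: "p = 2 * h" "h = a \<or> h = pi - a" and *:
    "t = \<alpha> - \<theta> + h + 2 * pi * of_int m" "q = \<theta> - \<beta> + h + 2 * pi * of_int n"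
    "0 \<le> t" "t < 2 * pi" "0 \<le> q" "q < 2 * pi"
    using RLR_angles[OF assms(2)] by metis
  show ?thesis
  proof (cases "h = a")
    case True
    then have "t = \<alpha> - \<theta> + a + 2 * pi \<or> t = 0"
      using arc_eq(1,2)[OF *(1,3,4)] ta_near[OF assms(1)] ab a \<theta> pi_gt_zero by (smt (verit))
    moreover have "q = \<theta> - \<beta> + a + 2 * pi \<or> q = 0"
      using arc_eq(1,2)[OF *(2,5,6)] True bt ab a \<theta> pi_gt_zero by (smt (verit))
    ultimately show ?thesis using True h by auto
  next
    case False
    then show ?thesis using h RLR_long[OF assms(2)] by auto
  qed
qed

lemma LRL_length_far:
  assumes "far" "dubins_path LRL \<alpha> d \<beta> t p q"
  shows "t + p + q = 4 * pi - 4 * b + (\<beta> - \<alpha>) \<or> t + p + q = 2 * pi + 4 * b + (\<beta> - \<alpha>) \<or> t = 0"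
proof -
  obtain h and m n :: int where h: "p = 2 * h" "h = b \<or> h = pi - b" and *:
    "t = \<psi> - \<alpha> + h + 2 * pi * of_int m" "q = \<beta> - \<psi> + h + 2 * pi * of_int n"
    "0 \<le> t" "t < 2 * pi" "0 \<le> q" "q < 2 * pi"
    using LRL_angles[OF assms(2)] by metis
  note bp = bp_far[OF assms(1)]
  have "q = \<beta> - \<psi> + h" using arc_eq(1)[OF *(2,5,6)] h bp ab b \<psi> by auto
  moreover have "t = \<psi> - \<alpha> + h + 2 * pi \<or> t = 0" if "h = b"
    using arc_eq(1,2)[OF *(1,3,4)] that ap ab b \<psi> pi_gt_zero by (smt (verit))
  moreover have "t = \<psi> - \<alpha> + h" if "h = pi - b"
    using arc_eq(1)[OF *(1,3,4)] that ap ab b \<psi> by auto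
  ultimately show ?thesis using h by auto
qed

lemma LRL_long_exists_near:
  assumes "\<not> far"
  shows "dubins_path LRL \<alpha> d \<beta> (\<psi> - \<alpha> + pi - b) (2 * pi - 2 * b) (\<beta> - \<psi> - pi - b)"
proof -
  have h: "(2 * pi - 2 * b) / 2 = pi - b" by (simp add: diff_divide_distrib)
  have \<psi>': "\<alpha> + (\<psi> - \<alpha> + pi - b) - (pi - b) = \<psi>" by simp
  have "\<alpha> + (\<psi> - \<alpha> + pi - b) - (2 * pi - 2 * b) + (\<beta> - \<psi> - pi - b) = \<beta> + 2 * pi * of_int (-1)"
    by simp
  then have "\<exists>k::int. \<alpha> + (\<psi> - \<alpha> + pi - b) - (2 * pi - 2 * b) + (\<beta> - \<psi> - pi - b) = \<beta> + 2 * pi * of_int k"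
    by blast
  then show ?thesis
    unfolding dubins_LRL_iff h \<psi>' using ll bp_near[OF assms] ap ab b \<psi> pi_gt_zero by auto
qed

lemma LRL_length_near:
  assumes "\<not> far" "dubins_path LRL \<alpha> d \<beta> t p q"
  shows "2 * pi - 4 * b + (\<beta> - \<alpha>) \<le> t + p + q"
proof -
  obtain h and m n :: int where h: "p = 2 * h" "h = b \<or> h = pi - b" and *:
    "t = \<psi> - \<alpha> + h + 2 * pi * of_int m" "q = \<beta> - \<psi> + h + 2 * pi * of_int n"
    "0 \<le> t" "t < 2 * pi" "0 \<le> q" "q < 2 * pi"
    using LRL_angles[OF assms(2)] by metis
  note bp = bp_near[OF assms(1)]
  show ?thesis
  proof (cases "h = b")
    case False
    then have p: "h = pi - b" using h by simp
    have "t = \<psi> - \<alpha> + h" using arc_eq(1)[OF *(1,3,4)] p ap ab b \<psi> by auto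
    moreover have "q = \<beta> - \<psi> + h - 2 * pi" using arc_eq(3)[OF *(2,5,6)] p bp ap ab b \<psi> by auto
    ultimately show ?thesis using p h by simp
  next
    case p: True
    \<comment> \<open>Failure would force the extreme headings and \<open>\<psi> = b - pi\<close>,
      where \<open>ll\<close> makes \<open>d\<close> equal to \<open>- 4 * sin b * cos b\<close>,
      which is not positive.\<close>
    have "\<beta> - \<psi> + b < 2 * pi"
    proof (rule ccontr)
      assume "\<not> ?thesis"
      then have "\<alpha> = 0" "\<beta> = pi" "\<psi> = b - pi" using ap ab by auto
      then have "4 * sin b * cos (b - pi) = d" using ll by simp
      moreover have "0 \<le> 4 * sin b * cos b" using b signs by (simp add: cos_ge_zero)
      ultimately show False using d_pos by (simp add: cos_diff)
    qed
    then have q: "q = \<beta> - \<psi> + b" using arc_eq(1)[OF *(2,5,6)] p ab b \<psi> by auto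
    show ?thesis
    proof (cases "\<alpha> - \<psi> = b")
      case False
      then have "t = \<psi> - \<alpha> + b + 2 * pi" using arc_eq(2)[OF *(1,3,4)] p ap ab b \<psi> by auto
      then show ?thesis using p q b h by simp
    next
      case True
      \<comment> \<open>If \<open>t\<close> does not gain a full turn, \<open>bp_near\<close> forces
        the extreme headings. Then \<open>b = pi / 4\<close>, exactly where
        \<open>pi + 4 * b\<close> reaches the required \<open>3 * pi - 4 * b\<close>.\<close>
      then have eq: "\<alpha> = 0" "\<beta> = pi" "\<psi> = - b" using bp ab by auto
      then have "4 * sin b * sin b = 2" using ll by simp
      then have "cos (2 * b) = cos (pi / 2)" by (simp add: cos_double_sin power2_eq_square)
      then have "2 * b = pi / 2" using cos_inj_pi[of "2 * b" "pi / 2"] b by simp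
      then show ?thesis using p q eq h *(3) by simp
    qed
  qed
qed

end

section \<open>The LSR paths and the case of meeting circles\<close>

lemma tangent_sq:
  fixes p h E F :: real
  assumes "p * cos h + 2 * sin h = E" "p * sin h - 2 * cos h = F"
  shows "p\<^sup>2 + 4 = E\<^sup>2 + F\<^sup>2"
  unfolding assms[symmetric] using sin_cos_squared_add[of h] by algebra

lemma tangent_rotate:
  fixes p h g E F :: real
  assumes "p * cos h + 2 * sin h = E" "p * sin h - 2 * cos h = F"
  shows "p * cos (h - g) + 2 * sin (h - g) = cos g * E + sin g * F"
    "p * sin (h - g) - 2 * cos (h - g) = cos g * F - sin g * E"
  unfolding assms[symmetric] cos_diff sin_diff by algebra+

lemma pi_sq_ge_8: "8 \<le> pi\<^sup>2"
proof -
  have "sqrt 2 / 2 \<le> pi / 4" using sin_x_le_x[of "pi / 4"] by (simp add: sin_45)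
  then have "(2 * sqrt 2)\<^sup>2 \<le> pi\<^sup>2" by (intro power_mono) auto
  then show ?thesis by (simp add: power_mult_distrib)
qed

lemma two_sub_cos_le: "2 * (1 - cos x) \<le> x\<^sup>2" for x :: real
proof -
  have "(sin (x / 2))\<^sup>2 \<le> (x / 2)\<^sup>2"
    using abs_sin_x_le_abs_x[of "x / 2"] abs_le_square_iff by blast
  moreover have "cos x = 1 - 2 * (sin (x / 2))\<^sup>2" using cos_double_sin[of "x / 2"] by simp
  ultimately show ?thesis by (simp add: power_divide)
qed

context short_a12
begin

section \<open>Angle bound when \<open>C_il\<close> meets \<open>C_fr\<close>\<close>

lemma sin_sum_halves:
  "d + sin \<beta> - sin \<alpha> = d + 2 * sin ((\<beta> - \<alpha>) / 2) * cos ((\<alpha> + \<beta>) / 2)"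
  "cos \<alpha> - cos \<beta> = 2 * sin ((\<beta> - \<alpha>) / 2) * sin ((\<alpha> + \<beta>) / 2)"
  "sin \<alpha> + sin \<beta> = 2 * cos ((\<beta> - \<alpha>) / 2) * sin ((\<alpha> + \<beta>) / 2)"
  "cos \<alpha> + cos \<beta> = 2 * cos ((\<beta> - \<alpha>) / 2) * cos ((\<alpha> + \<beta>) / 2)"
  using sin_diff_sin[of \<beta> \<alpha>] cos_diff_cos[of \<alpha> \<beta>] sin_plus_sin[of \<beta> \<alpha>] cos_plus_cos[of \<beta> \<alpha>]
  by (simp_all add: add.commute)

text \<open>With \<open>s = sin u\<close>, \<open>k = cos u\<close> and \<open>v = (\<alpha> + \<beta>) / 2\<close>, the laws of cosines for the two centre
  distances combine to \<open>d s cos v = 2 sin (a + b) sin (a - b)\<close> and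
  \<open>d\<^sup>2 + 4 s\<^sup>2 = 8 - 8 cos (a + b) cos (a - b)\<close>; \<open>sin (a - b) > k\<close> would then force \<open>k = 0\<close>.\<close>

lemma near_angle_bound:
  assumes near: "\<not> far"
  shows "a - b \<le> pi / 2 - (\<beta> - \<alpha>) / 2"
proof -
  define u v where "u = (\<beta> - \<alpha>) / 2" and "v = (\<alpha> + \<beta>) / 2"
  have u: "0 \<le> u" "u \<le> pi / 2" "u \<le> v" "v \<le> pi" using ab by (auto simp: u_def v_def field_simps)
  define s k where "s = sin u" and "k = cos u"
  have sk: "0 \<le> s" "0 \<le> k" "s\<^sup>2 + k\<^sup>2 = 1" using u by (auto simp: s_def k_def sin_ge_zero cos_ge_zero)
  have cv: "cos v \<le> k" unfolding k_def using u by (intro cos_monotone_0_pi_le) auto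
  have sv: "0 \<le> sin v" using u by (intro sin_ge_zero) auto
  note hs = sin_sum_halves[folded u_def v_def, folded s_def k_def]
  have A: "(4 * sin a)\<^sup>2 = d\<^sup>2 + 4 * s\<^sup>2 + 4 * d * s * cos v"
    unfolding rr_sq hs using sin_cos_squared_add[of v] by algebra
  have "d - sin \<beta> + sin \<alpha> = d - 2 * s * cos v" "cos \<beta> - cos \<alpha> = - (2 * s * sin v)"
    using hs(1,2) by auto
  then have B: "(4 * sin b)\<^sup>2 = d\<^sup>2 + 4 * s\<^sup>2 - 4 * d * s * cos v"
    unfolding ll_sq using sin_cos_squared_add[of v] by algebra
  have "sin (a + b) * sin (a - b) = (sin a)\<^sup>2 - (sin b)\<^sup>2"
    unfolding sin_add sin_diff using sin_cos_squared_add[of a] sin_cos_squared_add[of b] by algebra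
  then have diff: "d * s * cos v = 2 * (sin (a + b) * sin (a - b))" using A B by (simp add: power_mult_distrib)
  have "cos (a + b) * cos (a - b) = 1 - (sin a)\<^sup>2 - (sin b)\<^sup>2"
    unfolding cos_add cos_diff using sin_cos_squared_add[of a] sin_cos_squared_add[of b] by algebra
  then have sum: "8 * (cos (a + b) * cos (a - b)) = 8 - (d\<^sup>2 + 4 * s\<^sup>2)" using A B by (simp add: power_mult_distrib)
  have "(d + (sin \<alpha> + sin \<beta>))\<^sup>2 + (cos \<alpha> + cos \<beta>)\<^sup>2 \<le> 4" using near by (simp add: far_def add.assoc)
  then have "d\<^sup>2 + 4 * d * k * sin v + 4 * k\<^sup>2 \<le> 4"
    unfolding hs
  proof -
    have "(d + 2 * k * sin v)\<^sup>2 + (2 * k * cos v)\<^sup>2 = d\<^sup>2 + 4 * d * k * sin v + 4 * k\<^sup>2"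
      using sin_cos_squared_add[of v] by algebra
    then show "(d + 2 * k * sin v)\<^sup>2 + (2 * k * cos v)\<^sup>2 \<le> 4 \<Longrightarrow>
      d\<^sup>2 + 4 * d * k * sin v + 4 * k\<^sup>2 \<le> 4" by linarith
  qed
  moreover have "0 \<le> 4 * d * k * sin v" using d_pos sk sv by simp
  ultimately have ds: "d\<^sup>2 \<le> 4 * s\<^sup>2" using sk by simp
  have "sin (a - b) \<le> k"
  proof (rule ccontr)
    assume "\<not> sin (a - b) \<le> k"
    then have sd: "k < sin (a - b)" by simp
    have "b < a"
    proof (rule ccontr)
      assume "\<not> b < a"
      then have "0 \<le> sin (b - a)" using a b by (intro sin_ge_zero) auto
      then show False using sd sk sin_minus[of "a - b"] by simp
    qed
    then have ss: "0 < sin (a + b)" using a b by (intro sin_gt_zero) auto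
    \<comment> \<open>Since \<open>cos v \<le> k < sin (a - b)\<close>, cancelling
      \<open>sin (a - b)\<close> in \<open>diff\<close> bounds \<open>sin (a + b)\<close> by
      \<open>d * s / 2\<close>. Together with the bound on \<open>cos (a + b)\<close> from
      \<open>sum\<close> and with \<open>ds\<close>, this gives
      \<open>d\<^sup>2 \<le> d\<^sup>2 * s\<^sup>2\<close>.\<close>
    have "d * s * cos v \<le> d * s * sin (a - b)"
      using d_pos sk cv sd by (intro mult_left_mono) auto
    then have "2 * sin (a + b) \<le> d * s"
      using diff sd sk mult_right_le_imp_le[of "2 * sin (a + b)" "sin (a - b)" "d * s"] by simp
    then have "(2 * sin (a + b))\<^sup>2 \<le> (d * s)\<^sup>2" using ss by (intro power_mono) auto
    then have s2: "4 * (sin (a + b))\<^sup>2 \<le> d\<^sup>2 * s\<^sup>2" by (simp add: power_mult_distrib)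
    have cd: "0 < cos (a - b)" using a b by (intro cos_gt_zero_pi) auto
    have "0 \<le> cos (a + b) * cos (a - b)" using sum ds sk by (smt (verit) zero_le_power2)
    then have cs: "0 \<le> cos (a + b)" using cd by (simp add: zero_le_mult_iff)
    have "cos (a + b) \<le> cos \<bar>a - b\<bar>" using a b by (intro cos_monotone_0_pi_le) auto
    then have "cos (a + b) * cos (a + b) \<le> cos (a + b) * cos (a - b)"
      using cs by (intro mult_left_mono) auto
    then have "8 * (cos (a + b))\<^sup>2 \<le> 8 - (d\<^sup>2 + 4 * s\<^sup>2)" using sum by (simp add: power2_eq_square)
    then have "2 * d\<^sup>2 \<le> 2 * (d\<^sup>2 * s\<^sup>2)" using s2 ds sin_cos_squared_add[of "a + b"] by linarith
    then have "0 \<le> d\<^sup>2 * (s\<^sup>2 - 1)" by (simp add: algebra_simps)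
    then have "1 \<le> s\<^sup>2" using d_pos by (simp add: zero_le_mult_iff)
    then have "k\<^sup>2 \<le> 0" using sk by linarith
    then have "k = 0" by simp
    then have "d * s * cos v \<le> 0" using cv d_pos sk by (simp add: mult_nonneg_nonpos)
    moreover have "0 < sin (a + b) * sin (a - b)" using ss sd sk by simp
    ultimately show False using diff by linarith
  qed
  then have "sin (a - b) \<le> sin (pi / 2 - u)" unfolding k_def by (simp add: cos_sin_eq)
  then have "a - b \<le> pi / 2 - u"
    using sin_monotone_2pi[of "pi / 2 - u" "a - b"] a b u by fastforce
  then show ?thesis unfolding u_def .
qed

section \<open>Arcs, bounds, existence and uniqueness of LSR paths\<close>

lemma LSR_eqs:
  assumes "dubins_path LSR \<alpha> d \<beta> t p q"
  shows "0 \<le> t" "t < 2 * pi" "0 \<le> p" "0 \<le> q" "q < 2 * pi"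
    and "p\<^sup>2 + 4 = (d + sin \<alpha> + sin \<beta>)\<^sup>2 + (cos \<alpha> + cos \<beta>)\<^sup>2"
    and "p * cos t + 2 * sin t = d * cos \<alpha> + sin (\<beta> - \<alpha>)"
    and "p * sin t - 2 * cos t = - (d * sin \<alpha> + 1 + cos (\<beta> - \<alpha>))"
    and "p * cos (t - (\<beta> - \<alpha>)) + 2 * sin (t - (\<beta> - \<alpha>)) = d * cos \<beta> - sin (\<beta> - \<alpha>)"
    and "p * sin (t - (\<beta> - \<alpha>)) - 2 * cos (t - (\<beta> - \<alpha>)) = - (d * sin \<beta> + 1 + cos (\<beta> - \<alpha>))"
    and "(4 * sin a)\<^sup>2 = p\<^sup>2 + 4 * p * sin t + 8 * (1 - cos t)"
    and "(4 * sin b)\<^sup>2 = p\<^sup>2 + 4 * p * sin (t - (\<beta> - \<alpha>)) + 8 * (1 - cos (t - (\<beta> - \<alpha>)))"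
    and "\<exists>n::int. q = t - (\<beta> - \<alpha>) + 2 * pi * of_int n"
proof -
  show r: "0 \<le> t" "t < 2 * pi" "0 \<le> p" "0 \<le> q" "q < 2 * pi"
    using assms unfolding dubins_LSR_iff by auto
  have e: "p * cos (\<alpha> + t) + 2 * sin (\<alpha> + t) = d + sin \<beta> + sin \<alpha>"
    "p * sin (\<alpha> + t) - 2 * cos (\<alpha> + t) = - cos \<alpha> - cos \<beta>"
    using assms unfolding dubins_LSR_iff by auto
  have h: "\<alpha> + t - \<alpha> = t" "\<alpha> + t - \<beta> = t - (\<beta> - \<alpha>)" by simp_all
  \<comment> \<open>Turning the frame by the initial or by the final heading gives equations in
    \<open>t\<close> or in \<open>t - (\<beta> - \<alpha>)\<close>, the latter being
    \<open>q\<close> modulo full turns.\<close>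
  note ra = tangent_rotate[OF e, of \<alpha>, unfolded h] and rb = tangent_rotate[OF e, of \<beta>, unfolded h]
  show sq: "p\<^sup>2 + 4 = (d + sin \<alpha> + sin \<beta>)\<^sup>2 + (cos \<alpha> + cos \<beta>)\<^sup>2"
    unfolding tangent_sq[OF e] by (simp add: power2_eq_square algebra_simps)
  note un = sin_cos_squared_add[of \<alpha>] sin_cos_squared_add[of \<beta>]
  show "p * cos t + 2 * sin t = d * cos \<alpha> + sin (\<beta> - \<alpha>)"
    unfolding ra sin_diff by algebra
  show "p * cos (t - (\<beta> - \<alpha>)) + 2 * sin (t - (\<beta> - \<alpha>)) = d * cos \<beta> - sin (\<beta> - \<alpha>)"
    unfolding rb unfolding sin_diff by algebra
  show a2: "p * sin t - 2 * cos t = - (d * sin \<alpha> + 1 + cos (\<beta> - \<alpha>))"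
    unfolding ra cos_diff using un by algebra
  show b2: "p * sin (t - (\<beta> - \<alpha>)) - 2 * cos (t - (\<beta> - \<alpha>)) = - (d * sin \<beta> + 1 + cos (\<beta> - \<alpha>))"
    unfolding rb unfolding cos_diff using un by algebra
  have "(4 * sin a)\<^sup>2 = p\<^sup>2 + 8 - 4 * (d * sin \<alpha> + 1 + cos (\<beta> - \<alpha>))"
    using rr_sq sq un unfolding cos_diff by algebra
  then show "(4 * sin a)\<^sup>2 = p\<^sup>2 + 4 * p * sin t + 8 * (1 - cos t)" using a2 by algebra
  have "(4 * sin b)\<^sup>2 = p\<^sup>2 + 8 - 4 * (d * sin \<beta> + 1 + cos (\<beta> - \<alpha>))"
    using ll_sq sq un unfolding cos_diff by algebra
  then show "(4 * sin b)\<^sup>2 = p\<^sup>2 + 4 * p * sin (t - (\<beta> - \<alpha>)) + 8 * (1 - cos (t - (\<beta> - \<alpha>)))" using b2 by algebra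
  obtain l :: int where l: "\<alpha> + t - q = \<beta> + 2 * pi * of_int l"
    using assms unfolding dubins_LSR_iff by auto
  have "q = t - (\<beta> - \<alpha>) + 2 * pi * of_int (- l)" using l by simp
  then show "\<exists>n::int. q = t - (\<beta> - \<alpha>) + 2 * pi * of_int n" by blast
qed

lemma LSR_near_imp_LRL:
  assumes "\<not> far" "dubins_path LSR \<alpha> d \<beta> t p q"
  shows "p = 0" "dubins_path LRL \<alpha> d \<beta> t q 0"
proof -
  have "p\<^sup>2 + 4 \<le> 4" using LSR_eqs(6)[OF assms(2)] assms(1) by (simp add: far_def)
  then show "p = 0" by simp
  then show "dubins_path LRL \<alpha> d \<beta> t q 0" using assms dubins_path_drop_empty(5) by simp
qed

text \<open>Translates the case distinction on RSR into the transverse LSR equation in the frame of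
  the initial heading.\<close>

lemma \<theta>_le_\<alpha>_iff: "\<theta> \<le> \<alpha> \<longleftrightarrow> 2 \<le> d * sin \<alpha> + 1 + cos (\<beta> - \<alpha>)"
proof -
  have e: "4 * sin a * sin (\<alpha> - \<theta>) = d * sin \<alpha> - 1 + cos (\<beta> - \<alpha>)"
    using polar_sin_diff[OF rr, of \<alpha>] sin_cos_squared_add[of \<alpha>] unfolding cos_diff by algebra
  show ?thesis
  proof
    assume "\<theta> \<le> \<alpha>"
    then have "0 \<le> sin (\<alpha> - \<theta>)" using ab \<theta> by (intro sin_ge_zero) auto
    then have "0 \<le> 4 * sin a * sin (\<alpha> - \<theta>)" using signs by simp
    then show "2 \<le> d * sin \<alpha> + 1 + cos (\<beta> - \<alpha>)" using e by simp
  next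
    assume *: "2 \<le> d * sin \<alpha> + 1 + cos (\<beta> - \<alpha>)"
    show "\<theta> \<le> \<alpha>"
    proof (rule ccontr)
      assume "\<not> \<theta> \<le> \<alpha>"
      then have "0 < sin (\<theta> - \<alpha>)" using bt ab a by (intro sin_gt_zero) auto
      then have "sin (\<alpha> - \<theta>) < 0" using sin_minus[of "\<theta> - \<alpha>"] by simp
      then have "4 * sin a * sin (\<alpha> - \<theta>) < 0" using signs by (simp add: mult_pos_neg)
      then show False using e * by simp
    qed
  qed
qed

text \<open>For \<open>t = 0\<close> the path is also RSR. Otherwise the rotated equations give
  \<open>sin t \<le> 0 \<le> cos t\<close>, so both arcs are long and the length is at least
  \<open>p + 3 * pi - (\<beta> - \<alpha>)\<close>; it remains that
  \<open>4 * sin a \<le> p + pi\<close>.\<close>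

lemma LSR_length_case_i:
  assumes "far" "\<theta> \<le> \<alpha>" "dubins_path LSR \<alpha> d \<beta> t p q"
  shows "2 * pi - (\<beta> - \<alpha>) + 4 * sin a \<le> t + p + q"
proof (cases "t = 0")
  case True
  then have "dubins_path RSR \<alpha> d \<beta> t p q" using assms dubins_path_drop_empty(6) by simp
  then show ?thesis using RSR_angles[of t p q] assms(2) by simp
next
  case False
  note L = LSR_eqs[OF assms(3)]
  have "p\<^sup>2 + 4 > 4" using L(6) assms(1) by (simp add: far_def)
  then have p: "0 < p" using L(3) by (cases "p = 0") auto
  have "p * sin t \<le> 2 * cos t - 2" using L(8) assms(2) \<theta>_le_\<alpha>_iff by simp
  also have "\<dots> \<le> 0" by simp
  finally have st: "sin t \<le> 0" using p by (simp add: mult_le_0_iff)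
  have t: "pi \<le> t"
  proof (rule ccontr)
    assume "\<not> pi \<le> t"
    then show False using sin_gt_zero[of t] False L(1) st by simp
  qed
  have "0 \<le> d * cos \<alpha> + sin (\<beta> - \<alpha>)" using d_pos signs ab by (simp add: sin_ge_zero)
  then have "0 \<le> p * cos t" using L(7) st by linarith
  then have ct: "0 \<le> cos t" using p by (simp add: zero_le_mult_iff)
  have t': "3 * pi / 2 \<le> t"
  proof (rule ccontr)
    assume "\<not> 3 * pi / 2 \<le> t"
    then have "0 < cos (t - pi)" using t by (intro cos_gt_zero_pi) auto
    then show False using ct by (simp add: cos_diff)
  qed
  obtain n :: int where n: "q = t - (\<beta> - \<alpha>) + 2 * pi * of_int n" using L(13) by blast
  have q: "q = t - (\<beta> - \<alpha>)" using arc_eq(1)[OF n] L ab t' by simp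
  have "p * sin t \<le> 0" using p st by (simp add: mult_nonneg_nonpos)
  then have "(4 * sin a)\<^sup>2 \<le> p\<^sup>2 + 8" using L(11) ct by simp
  also have "\<dots> \<le> (p + pi)\<^sup>2"
  proof -
    have "0 \<le> 2 * p * pi" using p by simp
    then show ?thesis using pi_sq_ge_8 unfolding power2_sum by linarith
  qed
  finally have "4 * sin a \<le> p + pi" using p power2_le_imp_le[of "4 * sin a" "p + pi"] by simp
  then show ?thesis using q t' by simp
qed

text \<open>Solving the rotated equations linearly for sine and cosine, with determinant
  \<open>p\<^sup>2 + 4\<close>, gives their signs. Here \<open>M < 2\<close> makes
  \<open>sin t\<close> positive, and \<open>X' \<le> 0 \<le> M'\<close> puts \<open>t\<close> below
  \<open>\<beta> - \<alpha>\<close>.\<close>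

lemma LSR_case_ii:
  assumes "far" "\<alpha> < \<theta>" "dubins_path LSR \<alpha> d \<beta> t p q"
  shows "0 < p" "0 < t" "t \<le> pi / 2" "t < \<beta> - \<alpha>" "q = t - (\<beta> - \<alpha>) + 2 * pi"
proof -
  note L = LSR_eqs[OF assms(3)]
  have "p\<^sup>2 + 4 > 4" using L(6) assms(1) by (simp add: far_def)
  then show p: "0 < p" using L(3) by (cases "p = 0") auto
  have p4: "0 < p\<^sup>2 + 4" by (simp add: add_nonneg_pos)
  define X M where "X = d * cos \<alpha> + sin (\<beta> - \<alpha>)" and "M = d * sin \<alpha> + 1 + cos (\<beta> - \<alpha>)"
  define X' M' where "X' = d * cos \<beta> - sin (\<beta> - \<alpha>)" and "M' = d * sin \<beta> + 1 + cos (\<beta> - \<alpha>)"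
  have sw: "0 \<le> sin (\<beta> - \<alpha>)" using ab by (simp add: sin_ge_zero)
  have X: "0 \<le> X" unfolding X_def using d_pos signs sw by simp
  have c: "0 \<le> 1 + cos (\<beta> - \<alpha>)" using cos_ge_minus_one[of "\<beta> - \<alpha>"] by linarith
  have "0 \<le> d * sin \<alpha>" "0 \<le> d * sin \<beta>" "d * cos \<beta> \<le> 0"
    using d_pos signs by (auto simp: mult_nonneg_nonpos)
  then have M: "0 \<le> M" "M < 2" and M': "0 \<le> M'" and X': "X' \<le> 0"
    using c sw assms(2) \<theta>_le_\<alpha>_iff unfolding M_def M'_def X'_def by linarith+
  have e: "p * cos t + 2 * sin t = X" "p * sin t - 2 * cos t = - M" using L by (simp_all add: X_def M_def)
  have e': "p * cos (t - (\<beta> - \<alpha>)) + 2 * sin (t - (\<beta> - \<alpha>)) = X'"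
    "p * sin (t - (\<beta> - \<alpha>)) - 2 * cos (t - (\<beta> - \<alpha>)) = - M'" using L by (simp_all add: X'_def M'_def)
  have sq: "p\<^sup>2 + 4 = X\<^sup>2 + M\<^sup>2" using tangent_sq[OF e] by simp
  have sq': "p\<^sup>2 + 4 = X'\<^sup>2 + M'\<^sup>2" using tangent_sq[OF e'] by simp
  have "p * M < 2 * X"
  proof (rule ccontr)
    assume "\<not> p * M < 2 * X"
    then have "(2 * X)\<^sup>2 \<le> (p * M)\<^sup>2" using X by (intro power_mono) auto
    moreover have "(p * M)\<^sup>2 - (2 * X)\<^sup>2 = (p\<^sup>2 + 4) * (M\<^sup>2 - 4)" using sq by algebra
    ultimately have "0 \<le> (p\<^sup>2 + 4) * (M\<^sup>2 - 4)" by linarith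
    then have "4 \<le> M\<^sup>2" using p4 by (simp add: zero_le_mult_iff)
    moreover have "M\<^sup>2 < 2\<^sup>2" using M by (intro power_strict_mono) auto
    ultimately show False by simp
  qed
  moreover have "(p\<^sup>2 + 4) * sin t = 2 * (p * cos t + 2 * sin t) + p * (p * sin t - 2 * cos t)"
    by algebra
  then have "(p\<^sup>2 + 4) * sin t = 2 * X - p * M" unfolding e by simp
  ultimately have st: "0 < sin t" using p4 by (metis diff_gt_0_iff_gt zero_less_mult_pos)
  have "(p\<^sup>2 + 4) * cos t = p * (p * cos t + 2 * sin t) - 2 * (p * sin t - 2 * cos t)"
    by algebra
  then have "(p\<^sup>2 + 4) * cos t = p * X + 2 * M" unfolding e by simp
  moreover have "0 \<le> p * X + 2 * M" using p X M by simp
  ultimately have ct: "0 \<le> cos t" using p4 by (metis zero_le_mult_iff not_less)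
  show t0: "0 < t" using st L(1) by (cases "t = 0") auto
  have "t < pi" using sin_le_zero[of t] st L(2) by (meson not_le)
  show t: "t \<le> pi / 2"
  proof (rule ccontr)
    assume "\<not> t \<le> pi / 2"
    then have "0 < cos (pi - t)" using \<open>t < pi\<close> by (intro cos_gt_zero_pi) auto
    then show False using ct by simp
  qed
  show tw: "t < \<beta> - \<alpha>"
  proof (rule ccontr)
    assume "\<not> t < \<beta> - \<alpha>"
    then have "0 \<le> sin (t - (\<beta> - \<alpha>))" using t ab by (intro sin_ge_zero) auto
    moreover have "(p\<^sup>2 + 4) * sin (t - (\<beta> - \<alpha>)) =
        2 * (p * cos (t - (\<beta> - \<alpha>)) + 2 * sin (t - (\<beta> - \<alpha>)))
        + p * (p * sin (t - (\<beta> - \<alpha>)) - 2 * cos (t - (\<beta> - \<alpha>)))"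
      by algebra
    then have "(p\<^sup>2 + 4) * sin (t - (\<beta> - \<alpha>)) = 2 * X' - p * M'" unfolding e' by simp
    ultimately have "0 \<le> 2 * X' - p * M'" using p4 by (metis mult_nonneg_nonneg order_less_imp_le)
    moreover have "0 \<le> p * M'" using p M' by simp
    ultimately have "X' = 0" "p * M' = 0" using X' by linarith+
    then show False using sq' p4 p by simp
  qed
  obtain n :: int where n: "q = t - (\<beta> - \<alpha>) + 2 * pi * of_int n" using L(13) by blast
  show "q = t - (\<beta> - \<alpha>) + 2 * pi" using arc_eq(2)[OF n] L tw ab t0 by simp
qed

text \<open>The LSR length is \<open>2 * pi - (\<beta> - \<alpha>) + p + 2 * t\<close>. The bounds
  compare it with the RSR length of case (i), with RLR of middle arc \<open>2 * a\<close>, and with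
  LSL. For \<open>pi / 4 \<le> a\<close> the standard RLR path already bounds the RLR path of the
  second comparison.\<close>

lemma LSR_case_ii_bounds:
  assumes "far" "\<alpha> < \<theta>" "dubins_path LSR \<alpha> d \<beta> t p q"
  shows "4 * sin a \<le> p + 2 * t" "p + 2 * t \<le> 4 * a \<or> pi / 4 \<le> a"
    "p + 2 * t \<le> 2 * (\<beta> - \<alpha>) + 4 * sin b"
proof -
  note L = LSR_eqs[OF assms(3)] and T = LSR_case_ii[OF assms]
  have "sin t \<le> t" using T by (simp add: sin_x_le_x)
  then have "p * sin t \<le> p * t" using T by simp
  then have "(4 * sin a)\<^sup>2 \<le> p\<^sup>2 + 4 * (p * t) + 4 * t\<^sup>2" using L(11) two_sub_cos_le[of t] by linarith
  also have "\<dots> = (p + 2 * t)\<^sup>2" by (simp add: power2_eq_square algebra_simps)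
  finally show "4 * sin a \<le> p + 2 * t" using power2_le_imp_le[of "4 * sin a" "p + 2 * t"] T by simp
  \<comment> \<open>In these units \<open>p + 2 * t\<close> is \<open>4 * (\<tau> + y)\<close>, so
    the aim is \<open>sin (\<tau> + y) \<le> sin a\<close>. If \<open>\<tau> + y\<close> exceeds
    \<open>pi / 2\<close>, then \<open>y\<close> alone is large enough to give
    \<open>pi / 4 \<le> a\<close>.\<close>
  define \<tau> y where "\<tau> = t / 2" and "y = p / 4"
  have ty: "0 < \<tau>" "\<tau> \<le> pi / 4" "0 < y" "t = 2 * \<tau>" "p = 4 * y" using T by (auto simp: \<tau>_def y_def)
  have sa: "(sin a)\<^sup>2 = y\<^sup>2 + y * sin (2 * \<tau>) + (sin \<tau>)\<^sup>2"
    using L(11) unfolding ty(4,5) cos_double_sin by (simp add: power_mult_distrib)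
  have s2: "0 \<le> sin (2 * \<tau>)" using ty by (intro sin_ge_zero) auto
  show "p + 2 * t \<le> 4 * a \<or> pi / 4 \<le> a"
  proof (cases "\<tau> + y \<le> pi / 2")
    case True
    have "sin (2 * \<tau> + y) \<le> sin (2 * \<tau>) + y" using sin_abs_diff_le[of "2 * \<tau> + y" "2 * \<tau>"] ty by simp
    moreover have sy: "0 \<le> sin y" using ty True by (intro sin_ge_zero) auto
    ultimately have "sin y * sin (2 * \<tau> + y) \<le> sin y * (sin (2 * \<tau>) + y)" by (intro mult_left_mono)
    also have "\<dots> \<le> y * (sin (2 * \<tau>) + y)" using ty s2 by (intro mult_right_mono sin_x_le_x) auto
    finally have "sin y * sin (2 * \<tau> + y) \<le> y * (sin (2 * \<tau>) + y)" .
    moreover have "(sin (\<tau> + y))\<^sup>2 - (sin \<tau>)\<^sup>2 = sin y * sin (2 * \<tau> + y)"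
      unfolding sin_add[of "2 * \<tau>"] sin_add[of \<tau>] sin_double cos_double
      using sin_cos_squared_add[of \<tau>] sin_cos_squared_add[of y] by algebra
    ultimately have "(sin (\<tau> + y))\<^sup>2 \<le> (sin a)\<^sup>2" using sa by (simp add: power2_eq_square algebra_simps)
    then have "sin (\<tau> + y) \<le> sin a" using signs power2_le_imp_le by (meson less_imp_le)
    then have "\<tau> + y \<le> a" using sin_monotone_2pi[of a "\<tau> + y"] a True by fastforce
    then show ?thesis using ty by simp
  next
    case False
    then have "pi / 4 \<le> y" using ty by simp
    then have "(pi / 4)\<^sup>2 \<le> y\<^sup>2" by (intro power_mono) auto
    then have "pi\<^sup>2 / 16 \<le> y\<^sup>2" by (simp add: power_divide)
    moreover have "0 \<le> y * sin (2 * \<tau>)" using ty s2 by simp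
    moreover have "0 \<le> (sin \<tau>)\<^sup>2" by simp
    ultimately have "1 / 2 \<le> (sin a)\<^sup>2" using sa pi_sq_ge_8 by linarith
    then have "cos (2 * a) \<le> cos (pi / 2)" unfolding cos_double_sin by simp
    then have "pi / 2 \<le> 2 * a" using cos_monotone_0_pi[of "2 * a" "pi / 2"] a by fastforce
    then show ?thesis by simp
  qed
  \<comment> \<open>The third bound now reads \<open>p - 2 * x \<le> 4 * sin b\<close>. For
    \<open>2 * x \<le> p\<close> the difference of squares is nonnegative because
    \<open>sin x \<le> x\<close>.\<close>
  define x where "x = \<beta> - \<alpha> - t"
  have x: "0 < x" "t - (\<beta> - \<alpha>) = - x" using T by (auto simp: x_def)
  have B: "(4 * sin b)\<^sup>2 = p\<^sup>2 - 4 * p * sin x + 8 * (1 - cos x)" using L(12) unfolding x by simp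
  have "p - 2 * x \<le> 4 * sin b"
  proof (cases "2 * x \<le> p")
    case False
    then show ?thesis using signs by simp
  next
    case True
    have sx: "0 \<le> x - sin x" using x sin_x_le_x[of x] by simp
    then have "2 * x * (x - sin x) \<le> p * (x - sin x)" using True by (intro mult_right_mono) auto
    then have "0 \<le> 4 * (p * (x - sin x) - 2 * x * (x - sin x)) + 4 * ((x - sin x)\<^sup>2 + (1 - cos x)\<^sup>2)"
      by (intro add_nonneg_nonneg mult_nonneg_nonneg) auto
    also have "\<dots> = (4 * sin b)\<^sup>2 - (p - 2 * x)\<^sup>2"
      unfolding B using sin_cos_squared_add[of x] by algebra
    finally have "(p - 2 * x)\<^sup>2 \<le> (4 * sin b)\<^sup>2" by simp
    then show ?thesis using power2_le_imp_le[of "p - 2 * x" "4 * sin b"] signs by simp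
  qed
  then show "p + 2 * t \<le> 2 * (\<beta> - \<alpha>) + 4 * sin b" unfolding x_def by simp
qed

lemma LSR_exists:
  assumes "far" "\<alpha> < \<theta>"
  obtains t p q where "dubins_path LSR \<alpha> d \<beta> t p q"
proof -
  define E F where "E = d + sin \<beta> + sin \<alpha>" and "F = - cos \<alpha> - cos \<beta>"
  define p where "p = sqrt (E\<^sup>2 + F\<^sup>2 - 4)"
  have "E\<^sup>2 + F\<^sup>2 = (d + sin \<alpha> + sin \<beta>)\<^sup>2 + (cos \<alpha> + cos \<beta>)\<^sup>2"
    unfolding E_def F_def by (simp add: power2_eq_square algebra_simps)
  then have pos: "4 < E\<^sup>2 + F\<^sup>2" using assms by (simp add: far_def)
  then have p: "0 \<le> p" "p\<^sup>2 + 4 = E\<^sup>2 + F\<^sup>2" by (auto simp: p_def)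
  define R where "R = p\<^sup>2 + 4"
  have R: "0 < R" unfolding R_def by (simp add: add_nonneg_pos)
  \<comment> \<open>The quotients solve the tangent equations for cosine and sine of the heading
    \<open>h\<close> of the straight segment; they lie on the unit circle since \<open>R\<close>
    equals \<open>E\<^sup>2 + F\<^sup>2\<close>.\<close>
  have "((p * E - 2 * F) / R)\<^sup>2 + ((p * F + 2 * E) / R)\<^sup>2 = ((p\<^sup>2 + 4) * (E\<^sup>2 + F\<^sup>2)) / R\<^sup>2"
    unfolding power_divide add_divide_distrib[symmetric] by (rule arg_cong[where f = "\<lambda>z. z / R\<^sup>2"]) algebra
  also have "\<dots> = 1" using R p(2)[symmetric] unfolding R_def[symmetric] by (simp add: power2_eq_square)
  finally obtain h where h: "cos h = (p * E - 2 * F) / R" "sin h = (p * F + 2 * E) / R"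
    using sincos_total_2pi by metis
  have e: "p * cos h + 2 * sin h = E" "p * sin h - 2 * cos h = F"
  proof -
    have "p * cos h + 2 * sin h = (p * (p * E - 2 * F) + 2 * (p * F + 2 * E)) / R"
      unfolding h by (simp add: add_divide_distrib)
    also have "p * (p * E - 2 * F) + 2 * (p * F + 2 * E) = E * R" unfolding R_def by algebra
    finally show "p * cos h + 2 * sin h = E" using R by simp
    have "p * sin h - 2 * cos h = (p * (p * F + 2 * E) - 2 * (p * E - 2 * F)) / R"
      unfolding h by (simp add: diff_divide_distrib)
    also have "p * (p * F + 2 * E) - 2 * (p * E - 2 * F) = F * R" unfolding R_def by algebra
    finally show "p * sin h - 2 * cos h = F" using R by simp
  qed
  define arc where "arc x = x - 2 * pi * of_int \<lfloor>x / (2 * pi)\<rfloor>" for x :: real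
  have arc: "0 \<le> arc x" "arc x < 2 * pi" for x
    unfolding arc_def using floor_divide_lower[of "2 * pi" x] floor_divide_upper[of "2 * pi" x]
    by (auto simp: algebra_simps)
  have "\<alpha> + arc (h - \<alpha>) = h + 2 * pi * of_int (- \<lfloor>(h - \<alpha>) / (2 * pi)\<rfloor>)" by (simp add: arc_def)
  then have "sin (\<alpha> + arc (h - \<alpha>)) = sin h \<and> cos (\<alpha> + arc (h - \<alpha>)) = cos h"
    using sin_cos_eq_iff by blast
  moreover have "\<alpha> + arc (h - \<alpha>) - arc (h - \<beta>)
      = \<beta> + 2 * pi * of_int (\<lfloor>(h - \<beta>) / (2 * pi)\<rfloor> - \<lfloor>(h - \<alpha>) / (2 * pi)\<rfloor>)"
    by (simp add: arc_def algebra_simps)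
  then have "\<exists>k::int. \<alpha> + arc (h - \<alpha>) - arc (h - \<beta>) = \<beta> + 2 * pi * of_int k" by blast
  ultimately have "dubins_path LSR \<alpha> d \<beta> (arc (h - \<alpha>)) p (arc (h - \<beta>))"
    unfolding dubins_LSR_iff using e arc p E_def F_def by simp
  then show thesis using that by blast
qed

lemma LSR_unique:
  assumes "far" "\<alpha> < \<theta>" "dubins_path LSR \<alpha> d \<beta> t p q" "dubins_path LSR \<alpha> d \<beta> t' p' q'"
  shows "t' = t" "p' = p" "q' = q"
proof -
  note L = LSR_eqs[OF assms(3)] and L' = LSR_eqs[OF assms(4)]
  note T = LSR_case_ii[OF assms(1,2,3)] and T' = LSR_case_ii[OF assms(1,2,4)]
  have "p'\<^sup>2 = p\<^sup>2" using L(6) L'(6) by simp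
  then show p: "p' = p" using T T' by (simp add: power2_eq_iff)
  have "(p\<^sup>2 + 4) * cos t' = (p\<^sup>2 + 4) * cos t" using L(7,8) L'(7,8) unfolding p by algebra
  moreover have "p\<^sup>2 + 4 \<noteq> 0" using zero_le_power2[of p] by linarith
  ultimately have "cos t' = cos t" by simp
  then show t: "t' = t" using cos_inj_pi[of t' t] T T' by simp
  show "q' = q" using T T' t by simp
qed

end

section \<open>Comparison of the lengths\<close>

context short_a12
begin

text \<open>The last arc is empty, so this is the path through the point of tangency of \<open>C_ir\<close> and \<open>C_fl\<close>;
  its turning point has heading \<open>\<beta> - 2 a \<le> - \<pi>/3\<close>.\<close>

lemma exceptional_bound:
  assumes "dubins_path RLR \<alpha> d \<beta> t (2 * a) 0" "t = \<alpha> - \<theta> + a" "\<beta> - \<theta> = a"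
  shows "2 * pi \<le> 4 * a + 4 * sin a"
proof -
  have RSL: "dubins_path RSL \<alpha> d \<beta> t 0 (2 * a)" using dubins_RLR_imp_RSL[OF assms(1)] .
  have \<alpha>t: "\<alpha> - t = \<beta> - 2 * a" using assms by simp
  note e = dubins_RSL_imp(1,2)[OF RSL, unfolded \<alpha>t]
  have "(d - sin \<beta> - sin \<alpha>)\<^sup>2 + (cos \<alpha> + cos \<beta>)\<^sup>2 = 4"
    unfolding e[symmetric] using sin_cos_squared_add[of "\<beta> - 2 * a"] by algebra
  moreover have "(d - sin \<beta> - sin \<alpha>)\<^sup>2 + (cos \<alpha> + cos \<beta>)\<^sup>2 =
      d * (d - 2 * (sin \<alpha> + sin \<beta>)) + 2 + 2 * cos (\<beta> - \<alpha>)"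
    unfolding cos_diff using unit by algebra
  moreover have "0 \<le> 2 * (1 - cos (\<beta> - \<alpha>))" by simp
  ultimately have "0 \<le> d * (d - 2 * (sin \<alpha> + sin \<beta>))" by argo
  then have "0 \<le> d - 2 * (sin \<alpha> + sin \<beta>)" using d_pos by (simp add: zero_le_mult_iff)
  then have s: "sin (\<beta> - 2 * a) < 0" using e d_pos by simp
  have c: "cos (\<beta> - 2 * a) \<le> 1 / 2" using e(2) signs cos_le_one[of \<alpha>] by linarith
  have n: "\<beta> - 2 * a < 0"
  proof (rule ccontr)
    assume "\<not> \<beta> - 2 * a < 0"
    then have "0 \<le> sin (\<beta> - 2 * a)" using ab a by (intro sin_ge_zero) auto
    then show False using s by simp
  qed
  have "pi / 3 \<le> 2 * a - \<beta>"
  proof (rule ccontr)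
    assume "\<not> pi / 3 \<le> 2 * a - \<beta>"
    then have "cos (pi / 3) < cos (2 * a - \<beta>)" using n by (intro cos_monotone_0_pi) auto
    then show False using c cos_minus[of "\<beta> - 2 * a"] by (simp add: cos_60)
  qed
  then have a5: "5 * pi / 12 \<le> a" using ab by simp
  then have "sin (pi / 6) \<le> sin a" using a pi_gt_zero by (intro sin_monotone_2pi_le) linarith+
  then have "1 / 2 \<le> sin a" by (simp add: sin_30)
  then show ?thesis using a5 pi_less_4 by simp
qed

section \<open>Minimality in the three cases\<close>

lemma RLR_long_length:
  "(\<alpha> - \<theta> + pi - a) + (2 * pi - 2 * a) + (\<theta> - \<beta> + pi - a) = 4 * pi - 4 * a - (\<beta> - \<alpha>)"
  by simp

lemma shortest_isI:
  assumes "dubins_path w \<alpha> d \<beta> t p q"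
    and "\<And>w' t' p' q'. dubins_path w' \<alpha> d \<beta> t' p' q' \<Longrightarrow> t + p + q \<le> t' + p' + q'"
  shows "shortest_is w \<alpha> d \<beta>"
  using assms unfolding shortest_is_def by blast

text \<open>Common argument for cases (i) and (ii), with \<open>w\<close> the rival of the standard
  RLR path. Every path is at least as long as one of the two, except the exceptional tangent one. If
  that exists, \<open>ge\<close> and \<open>exceptional_bound\<close> show that the rival is not the
  shorter of the two. \<open>short\<close> covers RLR and LRL paths with short middle arc.\<close>

lemma far_shortest:
  assumes far
    and w: "dubins_path w \<alpha> d \<beta> t0 p0 q0"
    and ge: "2 * pi - (\<beta> - \<alpha>) + 4 * sin a \<le> t0 + p0 + q0"
    and lower: "\<And>w' t p q. dubins_path w' \<alpha> d \<beta> t p q \<Longrightarrow> w' \<in> {RSR, LSL, LSR} \<Longrightarrow>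
      4 * pi - 4 * a - (\<beta> - \<alpha>) \<le> t + p + q \<or> t0 + p0 + q0 \<le> t + p + q"
    and short: "4 * pi - 4 * a - (\<beta> - \<alpha>) \<le> 2 * pi + 4 * a - (\<beta> - \<alpha>) \<or>
      t0 + p0 + q0 \<le> 2 * pi + 4 * a - (\<beta> - \<alpha>)"
  shows "4 * pi - 4 * a - (\<beta> - \<alpha>) < t0 + p0 + q0 \<Longrightarrow> shortest_is RLR \<alpha> d \<beta>"
    and "t0 + p0 + q0 < 4 * pi - 4 * a - (\<beta> - \<alpha>) \<Longrightarrow> shortest_is w \<alpha> d \<beta>"
proof -
  let ?R = "4 * pi - 4 * a - (\<beta> - \<alpha>)"
  let ?L = "t0 + p0 + q0"
  define ex where "ex \<longleftrightarrow> dubins_path RLR \<alpha> d \<beta> (\<alpha> - \<theta> + a) (2 * a) 0 \<and> \<beta> - \<theta> = a"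
  have rlr: "?R \<le> t + p + q \<or> ?L \<le> t + p + q \<or> ex \<and> t + p + q = 4 * a - (\<beta> - \<alpha>)"
    if "dubins_path RLR \<alpha> d \<beta> t p q" for t p q
    using RLR_length_far[OF \<open>far\<close> that]
  proof (elim disjE)
    assume "t + p + q = 2 * pi + 4 * a - (\<beta> - \<alpha>)"
    then show ?thesis using short by auto
  next
    assume "p = 2 * a \<and> q = 0 \<and> t = \<alpha> - \<theta> + a \<and> \<beta> - \<theta> = a"
    then show ?thesis using that by (auto simp: ex_def)
  qed auto
  have lrl: "?R \<le> t + p + q \<or> ?L \<le> t + p + q \<or> ex \<and> t + p + q = 4 * a - (\<beta> - \<alpha>)"
    if *: "dubins_path LRL \<alpha> d \<beta> t p q" for t p q
    using LRL_length_far[OF \<open>far\<close> that]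
  proof (elim disjE)
    assume "t = 0"
    then show ?thesis using rlr[of p q 0] dubins_path_drop_empty(3) * by simp
  next
    assume "t + p + q = 4 * pi - 4 * b + (\<beta> - \<alpha>)"
    then show ?thesis using ab_diff by auto
  next
    assume l: "t + p + q = 2 * pi + 4 * b + (\<beta> - \<alpha>)"
    have "4 * a - 4 * b \<le> 2 * (\<beta> - \<alpha>)" using ab_diff(2) by linarith
    then have "2 * pi + 4 * a - (\<beta> - \<alpha>) \<le> t + p + q" using l by argo
    then show ?thesis using short by linarith
  qed
  have all: "?R \<le> t + p + q \<or> ?L \<le> t + p + q \<or> ex \<and> t + p + q = 4 * a - (\<beta> - \<alpha>)"
    if *: "dubins_path w' \<alpha> d \<beta> t p q" for w' t p q
  proof (cases w')
    case RLR
    then show ?thesis using rlr[of t p q] * by simp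
  next
    case LRL
    then show ?thesis using lrl[of t p q] * by simp
  next
    case RSL
    then show ?thesis using lrl[of 0 t q] RSL_imp_LRL[of t p q] * by simp
  qed (use lower[OF *] in auto)
  have ex_len: "(\<alpha> - \<theta> + a) + 2 * a + 0 = 4 * a - (\<beta> - \<alpha>)" if ex using that by (simp add: ex_def)
  have ex_R: "?R \<le> ?L" if ex
    using exceptional_bound[of "\<alpha> - \<theta> + a"] that ge by (simp add: ex_def)
  show "shortest_is RLR \<alpha> d \<beta>" if "?R < ?L"
  \<comment> \<open>The exceptional path has type RLR too and, as \<open>a \<le> pi / 2\<close>, is
    no longer than the standard one, so it is the witness when it exists.\<close>
  proof (cases ex)
    case True
    show ?thesis
    proof (rule shortest_isI)
      show "dubins_path RLR \<alpha> d \<beta> (\<alpha> - \<theta> + a) (2 * a) 0" using True by (simp add: ex_def)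
      show "\<alpha> - \<theta> + a + 2 * a + 0 \<le> t' + p' + q'" if "dubins_path w' \<alpha> d \<beta> t' p' q'" for w' t' p' q'
        using all[OF that] ex_len[OF True] \<open>?R < ?L\<close> a by auto
    qed
  next
    case False
    show ?thesis
    proof (rule shortest_isI[OF RLR_long_exists], unfold RLR_long_length)
      show "?R \<le> t' + p' + q'" if "dubins_path w' \<alpha> d \<beta> t' p' q'" for w' t' p' q'
        using all[OF that] False \<open>?R < ?L\<close> by auto
    qed
  qed
  show "shortest_is w \<alpha> d \<beta>" if "?L < ?R"
    using shortest_isI[OF w] all ex_R that by fastforce
qed

lemma case_i_shortest:
  assumes far "\<theta> \<le> \<alpha>"
  shows "2 * pi - 4 * a - 4 * sin a < 0 \<Longrightarrow> shortest_is RLR \<alpha> d \<beta>"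
    and "0 < 2 * pi - 4 * a - 4 * sin a \<Longrightarrow> shortest_is RSR \<alpha> d \<beta>"
proof -
  have RSR: "dubins_path RSR \<alpha> d \<beta> (\<alpha> - \<theta>) (4 * sin a) (\<theta> - \<beta> + 2 * pi)"
    using RSR_exists assms(2) by simp
  have lower: "4 * pi - 4 * a - (\<beta> - \<alpha>) \<le> t + p + q \<or> \<alpha> - \<theta> + 4 * sin a + (\<theta> - \<beta> + 2 * pi) \<le> t + p + q"
    if *: "dubins_path w \<alpha> d \<beta> t p q" "w \<in> {RSR, LSL, LSR}" for w t p q
  proof -
    consider "w = RSR" | "w = LSL" | "w = LSR" using *(2) by auto
    then show ?thesis
    proof cases
      case 1
      then show ?thesis using RSR_angles[of t p q] * assms(2) by simp
    next
      case 2
      then show ?thesis using LSL_length[of t p q] * sin_ab_diff[THEN abs_le_D1] by simp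
    next
      case 3
      then show ?thesis using LSR_length_case_i[of t p q] * assms by simp
    qed
  qed
  have "sin a \<le> a" using a by (simp add: sin_x_le_x)
  then have short: "\<alpha> - \<theta> + 4 * sin a + (\<theta> - \<beta> + 2 * pi) \<le> 2 * pi + 4 * a - (\<beta> - \<alpha>)" by simp
  have ge: "2 * pi - (\<beta> - \<alpha>) + 4 * sin a \<le> \<alpha> - \<theta> + 4 * sin a + (\<theta> - \<beta> + 2 * pi)" by simp
  note F = far_shortest[OF \<open>far\<close> RSR ge lower disjI2[OF short]]
  show "2 * pi - 4 * a - 4 * sin a < 0 \<Longrightarrow> shortest_is RLR \<alpha> d \<beta>"
    by (rule F(1)) auto
  show "0 < 2 * pi - 4 * a - 4 * sin a \<Longrightarrow> shortest_is RSR \<alpha> d \<beta>"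
    by (rule F(2)) auto
qed

lemma case_ii_shortest:
  assumes far "\<alpha> < \<theta>" and LSR: "dubins_path LSR \<alpha> d \<beta> t0 p0 q0"
  shows "4 * pi - 4 * a - (\<beta> - \<alpha>) < t0 + p0 + q0 \<Longrightarrow> shortest_is RLR \<alpha> d \<beta>"
    and "t0 + p0 + q0 < 4 * pi - 4 * a - (\<beta> - \<alpha>) \<Longrightarrow> shortest_is LSR \<alpha> d \<beta>"
proof -
  note T = LSR_case_ii[OF assms] and B = LSR_case_ii_bounds[OF assms]
  have lower: "4 * pi - 4 * a - (\<beta> - \<alpha>) \<le> t + p + q \<or> t0 + p0 + q0 \<le> t + p + q"
    if *: "dubins_path w \<alpha> d \<beta> t p q" "w \<in> {RSR, LSL, LSR}" for w t p q
  proof -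
    consider "w = RSR" | "w = LSL" | "w = LSR" using *(2) by auto
    then show ?thesis
    proof cases
      case 1
      then show ?thesis using RSR_angles[of t p q] * assms(2) signs a by simp
    next
      case 2
      then show ?thesis using LSL_length[of t p q] * B(3) T by simp
    next
      case 3
      then show ?thesis using LSR_unique[OF assms, of t p q] * by simp
    qed
  qed
  have short: "4 * pi - 4 * a - (\<beta> - \<alpha>) \<le> 2 * pi + 4 * a - (\<beta> - \<alpha>) \<or> t0 + p0 + q0 \<le> 2 * pi + 4 * a - (\<beta> - \<alpha>)"
    using B(2) T by auto
  have ge: "2 * pi - (\<beta> - \<alpha>) + 4 * sin a \<le> t0 + p0 + q0" using B(1) T by simp
  note F = far_shortest[OF \<open>far\<close> LSR ge lower short]
  show "4 * pi - 4 * a - (\<beta> - \<alpha>) < t0 + p0 + q0 \<Longrightarrow> shortest_is RLR \<alpha> d \<beta>" by (rule F(1)) auto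
  show "t0 + p0 + q0 < 4 * pi - 4 * a - (\<beta> - \<alpha>) \<Longrightarrow> shortest_is LSR \<alpha> d \<beta>" by (rule F(2)) auto
qed

lemma near_shortest:
  assumes near: "\<not> far"
  shows "shortest_is LRL \<alpha> d \<beta>"
proof (rule shortest_isI[OF LRL_long_exists_near[OF near]])
  let ?N = "2 * pi - 4 * b + (\<beta> - \<alpha>)"
  fix w t p q
  assume *: "dubins_path w \<alpha> d \<beta> t p q"
  have "?N \<le> t + p + q"
  proof (cases w)
    case LSL
    then show ?thesis using LSL_length[of t p q] * signs b by simp
  next
    case RSR
    then show ?thesis using RSR_angles[of t p q] * ta_near[OF near] signs a b ab by simp
  next
    case LSR
    then show ?thesis using LSR_near_imp_LRL[OF near, of t p q] LRL_length_near[OF near, of t q 0] * by simp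
  next
    case RSL
    then show ?thesis using RSL_imp_LRL[of t p q] LRL_length_near[OF near, of 0 t q] * by simp
  next
    case RLR
    have "?N \<le> 4 * pi - 4 * a - (\<beta> - \<alpha>)" using near_angle_bound[OF near] by argo
    moreover have "?N \<le> 4 * pi + 4 * a - (\<beta> - \<alpha>)" using ab a b by simp
    moreover have "?N \<le> t + p + q" if "t = 0"
      using LRL_length_near[OF near, of p q 0] dubins_path_drop_empty(1) * RLR that by simp
    moreover have "?N \<le> t + p + q" if "q = 0"
      using LRL_length_near[OF near, of 0 t p] dubins_path_drop_empty(2) * RLR that by simp
    ultimately show ?thesis using RLR_length_near[OF near, of t p q] * RLR by auto
  next
    case LRL
    then show ?thesis using LRL_length_near[OF near, of t p q] * by simp
  qed
  then show "\<psi> - \<alpha> + pi - b + (2 * pi - 2 * b) + (\<beta> - \<psi> - pi - b) \<le> t + p + q" by simp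
qed

section \<open>Segment lengths of the standard construction\<close>

lemma seglens_RLR:
  "seglens RLR \<alpha> d \<beta> = (\<alpha> - \<theta> + pi - a, 2 * pi - 2 * a, \<theta> - \<beta> + pi - a)"
  unfolding seglens_def
proof (rule the_equality)
  show "std_path RLR \<alpha> d \<beta> (\<alpha> - \<theta> + pi - a, 2 * pi - 2 * a, \<theta> - \<beta> + pi - a)"
    using RLR_long_exists a by (simp add: std_path_def)
next
  fix x assume "std_path RLR \<alpha> d \<beta> x"
  then obtain t p q where x: "x = (t, p, q)" and *: "dubins_path RLR \<alpha> d \<beta> t p q" "pi \<le> p"
    by (cases x) (auto simp: std_path_def)
  \<comment> \<open>\<open>pi \<le> p\<close> excludes the middle arc \<open>2 * a\<close> unless
    \<open>a = pi / 2\<close>, where both candidates agree.\<close>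
  obtain h where "p = 2 * h" "h = a \<or> h = pi - a" using RLR_angles[OF *(1)] by metis
  then have p: "p = 2 * pi - 2 * a" using *(2) a by auto
  then show "x = (\<alpha> - \<theta> + pi - a, 2 * pi - 2 * a, \<theta> - \<beta> + pi - a)"
    using RLR_long[OF *(1)] x by simp
qed

lemma seglens_RSR:
  "seglens RSR \<alpha> d \<beta> =
    (if \<theta> \<le> \<alpha> then \<alpha> - \<theta> else \<alpha> - \<theta> + 2 * pi, 4 * sin a, \<theta> - \<beta> + 2 * pi)"
  unfolding seglens_def
proof (rule the_equality, goal_cases)
  case 1
  show ?case using RSR_exists by (simp add: std_path_def)
next
  case (2 x)
  then obtain t p q where "x = (t, p, q)" "dubins_path RSR \<alpha> d \<beta> t p q"
    by (cases x) (auto simp: std_path_def)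
  then show ?case using RSR_angles[of t p q] by simp
qed

lemma seglens_LSR:
  assumes far "\<alpha> < \<theta>" "dubins_path LSR \<alpha> d \<beta> t p q"
  shows "seglens LSR \<alpha> d \<beta> = (t, p, q)"
  unfolding seglens_def
proof (rule the_equality, goal_cases)
  case 1
  show ?case using assms(3) by (simp add: std_path_def)
next
  case (2 x)
  then obtain t' p' q' where "x = (t', p', q')" "dubins_path LSR \<alpha> d \<beta> t' p' q'"
    by (cases x) (auto simp: std_path_def)
  then show ?case using LSR_unique[OF assms, of t' p' q'] by simp
qed

end

text \<open>For \<open>d \<le> 1\<close> the circles \<open>C_ir\<close> and \<open>C_fl\<close> always meet; for \<open>d \<ge> 1\<close> each of the other three
  pairs can only meet if they do.\<close>

lemma short_path_imp_ir_fl_meet: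
  fixes \<alpha> \<beta> d :: real
  assumes d: "0 < d" and sg: "0 \<le> sin \<alpha>" "0 \<le> cos \<alpha>" "0 \<le> sin \<beta>" "cos \<beta> \<le> 0"
    and "(d - sin \<beta> + sin \<alpha>)\<^sup>2 + (cos \<beta> - cos \<alpha>)\<^sup>2 \<le> 4 \<or>
      (d + sin \<beta> - sin \<alpha>)\<^sup>2 + (cos \<alpha> - cos \<beta>)\<^sup>2 \<le> 4 \<or>
      (d + sin \<alpha> + sin \<beta>)\<^sup>2 + (cos \<alpha> + cos \<beta>)\<^sup>2 \<le> 4 \<or>
      (d - sin \<alpha> - sin \<beta>)\<^sup>2 + (cos \<alpha> + cos \<beta>)\<^sup>2 \<le> 4"
  shows "(d - sin \<alpha> - sin \<beta>)\<^sup>2 + (cos \<alpha> + cos \<beta>)\<^sup>2 \<le> 4"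
proof -
  define x y where "x = sin \<alpha>" and "y = sin \<beta>"
  define c where "c = cos \<alpha> * cos \<beta> + x * y"
  have xy: "0 \<le> x" "x \<le> 1" "0 \<le> y" "y \<le> 1" using sg by (auto simp: x_def y_def)
  have un: "(cos \<alpha>)\<^sup>2 = 1 - x\<^sup>2" "(cos \<beta>)\<^sup>2 = 1 - y\<^sup>2" by (simp_all add: x_def y_def cos_squared_eq)
  have c: "c \<le> x * y" using sg mult_nonneg_nonpos[of "cos \<alpha>" "cos \<beta>"] by (simp add: c_def)
  have ex: "(d - y + x)\<^sup>2 + (cos \<beta> - cos \<alpha>)\<^sup>2 = d\<^sup>2 - 2 * d * y + 2 * d * x + 2 - 2 * c"
    "(d + y - x)\<^sup>2 + (cos \<alpha> - cos \<beta>)\<^sup>2 = d\<^sup>2 + 2 * d * y - 2 * d * x + 2 - 2 * c"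
    "(d + x + y)\<^sup>2 + (cos \<alpha> + cos \<beta>)\<^sup>2 = d\<^sup>2 + 2 * d * y + 2 * d * x + 2 + 2 * c"
    "(d - x - y)\<^sup>2 + (cos \<alpha> + cos \<beta>)\<^sup>2 = d\<^sup>2 - 2 * d * y - 2 * d * x + 2 + 2 * c"
    using un unfolding c_def by algebra+
  have xy_le: "x * y \<le> x" "x * y \<le> y" using xy by (simp_all add: mult_left_le mult_left_le_one_le)
  have dxy: "0 \<le> d * x" "0 \<le> d * y" using d xy by simp_all
  have "d\<^sup>2 - 2 * d * y - 2 * d * x + 2 + 2 * c \<le> 4"
  proof (cases "d \<le> 1")
    case True
    have dd: "d\<^sup>2 \<le> d" using True d by (simp add: power2_eq_square mult_left_le)
    show ?thesis
    \<comment> \<open>If \<open>x + y\<close> is at least 1/2, the linear terms absorb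
      \<open>d\<^sup>2\<close>; otherwise \<open>x * y\<close> is small enough.\<close>
    proof (cases "1 / 2 \<le> x + y")
      case ge: True
      have "d * (1 / 2) \<le> d * (x + y)" using ge d by (intro mult_left_mono) auto
      then have "d \<le> 2 * d * y + 2 * d * x" by (simp add: algebra_simps)
      moreover have "x * y \<le> 1" using xy_le xy by linarith
      ultimately show ?thesis using c dd by linarith
    next
      case False
      then show ?thesis using c dd True xy_le dxy xy by linarith
    qed
  next
    case False
    \<comment> \<open>Passing to this pair from the others changes the squared distance by
      \<open>4 * c - 4 * d * x\<close>, \<open>4 * c - 4 * d * y\<close> or
      \<open>- 4 * d * x - 4 * d * y\<close>. None is positive, since
      \<open>c \<le> x * y\<close>.\<close>
    then have "x \<le> d * x" "y \<le> d * y" using xy by (simp_all add: mult_le_cancel_right1)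
    then show ?thesis
      using assms(6)[folded x_def y_def, unfolded ex] c xy_le dxy
      by (elim disjE) (auto simp: algebra_simps)
  qed
  then show ?thesis unfolding x_def[symmetric] y_def[symmetric] ex .
qed

section \<open>Existence of the angle data\<close>

lemma short_a12_exists:
  fixes \<alpha> \<beta> d :: real
  assumes d: "0 < d" and ab: "0 \<le> \<alpha>" "\<alpha> \<le> pi / 2" "pi / 2 \<le> \<beta>" "\<beta> \<le> pi"
    and rl: "(d - sin \<alpha> - sin \<beta>)\<^sup>2 + (cos \<alpha> + cos \<beta>)\<^sup>2 \<le> 4"
  obtains \<theta> \<psi> a b where "short_a12 \<alpha> \<beta> d \<theta> \<psi> a b"
proof -
  note sg = quadrant_signs[OF ab]
  have polar: "\<exists>h x. 0 < h \<and> h \<le> pi / 2 \<and> 0 \<le> x \<and> x \<le> pi \<and> 4 * sin h * cos x = X \<and> 4 * sin h * sin x = Y"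
    if "0 \<le> Y" "0 < X\<^sup>2 + Y\<^sup>2" "X\<^sup>2 + Y\<^sup>2 \<le> 16" for X Y :: real
  proof -
    define D where "D = sqrt (X\<^sup>2 + Y\<^sup>2)"
    have D: "0 < D" "D \<le> 4" "D\<^sup>2 = X\<^sup>2 + Y\<^sup>2" using that real_sqrt_le_mono[of "X\<^sup>2 + Y\<^sup>2" 16]
      by (auto simp: D_def)
    have "(X / D)\<^sup>2 + (Y / D)\<^sup>2 = 1" using D(1) unfolding power_divide add_divide_distrib[symmetric] D(3)[symmetric] by simp
    moreover have "0 \<le> Y / D" using that(1) D(1) by simp
    ultimately obtain x where x: "0 \<le> x" "x \<le> pi" "X / D = cos x" "Y / D = sin x"
      using sincos_total_pi[of "Y / D" "X / D"] by blast
    have s: "sin (arcsin (D / 4)) = D / 4" using D by (intro sin_arcsin) auto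
    have "0 < arcsin (D / 4)" using arcsin_less_mono[of 0 "D / 4"] D by simp
    moreover have "arcsin (D / 4) \<le> pi / 2" using D by (intro arcsin_ubound) auto
    moreover have "4 * sin (arcsin (D / 4)) * cos x = X" "4 * sin (arcsin (D / 4)) * sin x = Y"
      unfolding s x(3,4)[symmetric] using D by simp_all
    ultimately show ?thesis using x(1,2) by blast
  qed
  \<comment> \<open>Triangle inequality by the parallelogram law: a vector of length at most 2 plus
    one of length 2 has length at most 4.\<close>
  have tri: "(W + 2 * s)\<^sup>2 + (V - 2 * k)\<^sup>2 \<le> 16" if "W\<^sup>2 + V\<^sup>2 \<le> 4" "s\<^sup>2 + k\<^sup>2 = 1" for W V s k :: real
  proof -
    have "(W + 2 * s)\<^sup>2 + (V - 2 * k)\<^sup>2 + ((W - 2 * s)\<^sup>2 + (V + 2 * k)\<^sup>2) = 2 * (W\<^sup>2 + V\<^sup>2) + 8 * (s\<^sup>2 + k\<^sup>2)"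
      by (simp add: power2_eq_square algebra_simps)
    then show ?thesis using that by (smt (verit) zero_le_power2)
  qed
  have ub: "(d + sin \<beta> - sin \<alpha>)\<^sup>2 + (cos \<alpha> - cos \<beta>)\<^sup>2 \<le> 16" "(d - sin \<beta> + sin \<alpha>)\<^sup>2 + (cos \<alpha> - cos \<beta>)\<^sup>2 \<le> 16"
    using tri[OF rl, of "sin \<beta>" "cos \<beta>"] tri[OF rl, of "sin \<alpha>" "cos \<alpha>"]
    by (simp_all add: power2_commute[of "cos \<alpha>"] algebra_simps)
  have lb: "0 < (d + sin \<beta> - sin \<alpha>)\<^sup>2 + (cos \<alpha> - cos \<beta>)\<^sup>2" "0 < (d - sin \<beta> + sin \<alpha>)\<^sup>2 + (cos \<alpha> - cos \<beta>)\<^sup>2"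
  proof -
    have "d + sin \<beta> - sin \<alpha> \<noteq> 0 \<and> d - sin \<beta> + sin \<alpha> \<noteq> 0 \<or> cos \<alpha> - cos \<beta> \<noteq> 0"
    proof (cases "cos \<alpha> = cos \<beta>")
      case True
      then have "(sin \<alpha>)\<^sup>2 = (sin \<beta>)\<^sup>2" by (simp add: sin_squared_eq)
      then have "sin \<alpha> = sin \<beta>" using sg by (simp add: power2_eq_iff_nonneg)
      then show ?thesis using d by simp
    qed simp
    then show "0 < (d + sin \<beta> - sin \<alpha>)\<^sup>2 + (cos \<alpha> - cos \<beta>)\<^sup>2" "0 < (d - sin \<beta> + sin \<alpha>)\<^sup>2 + (cos \<alpha> - cos \<beta>)\<^sup>2"
      by (auto simp: sum_power2_gt_zero_iff)
  qed
  have y: "0 \<le> cos \<alpha> - cos \<beta>" using sg by simp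
  obtain a \<theta> where a: "0 < a" "a \<le> pi / 2" "0 \<le> \<theta>" "\<theta> \<le> pi"
    "4 * sin a * cos \<theta> = d + sin \<beta> - sin \<alpha>" "4 * sin a * sin \<theta> = cos \<alpha> - cos \<beta>"
    using polar[OF y lb(1) ub(1)] by blast
  obtain b \<psi> where b: "0 < b" "b \<le> pi / 2" "0 \<le> \<psi>" "\<psi> \<le> pi"
    "4 * sin b * cos \<psi> = d - sin \<beta> + sin \<alpha>" "4 * sin b * sin \<psi> = cos \<alpha> - cos \<beta>"
    using polar[OF y lb(2) ub(2)] by blast
  \<comment> \<open>The direction was found for the reflected vector with nonnegative second
    component, hence the sign.\<close>
  have "short_a12 \<alpha> \<beta> d \<theta> (- \<psi>) a b"
    by unfold_locales (use d ab rl a b in auto)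
  then show thesis using that by blast
qed

theorem theorem2:
  fixes \<alpha> \<beta> d :: real
  assumes "d > 0"
    and "0 \<le> \<alpha>" "\<alpha> \<le> pi / 2" and "pi / 2 \<le> \<beta>" "\<beta> \<le> pi"
    and "(C_il \<alpha> \<union> C_ir \<alpha>) \<inter> (C_fl d \<beta> \<union> C_fr d \<beta>) \<noteq> {}"
  defines "S1 \<equiv> 2 * (plen RLR \<alpha> d \<beta> - pi) - plen RSR \<alpha> d \<beta>"
    and "S2 \<equiv> 2 * (tlen RLR \<alpha> d \<beta> + qlen RLR \<alpha> d \<beta>)
               - (plen LSR \<alpha> d \<beta> + 2 * qlen LSR \<alpha> d \<beta>) + 2 * pi"
  shows "(C_il \<alpha> \<inter> C_fr d \<beta> = {} \<and> tlen RSR \<alpha> d \<beta> < pi \<longrightarrow>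
            (S1 < 0 \<longrightarrow> shortest_is RLR \<alpha> d \<beta>) \<and> (S1 > 0 \<longrightarrow> shortest_is RSR \<alpha> d \<beta>))
       \<and> (C_il \<alpha> \<inter> C_fr d \<beta> = {} \<and> tlen RSR \<alpha> d \<beta> > pi \<longrightarrow>
            (S2 < 0 \<longrightarrow> shortest_is RLR \<alpha> d \<beta>) \<and> (S2 > 0 \<longrightarrow> shortest_is LSR \<alpha> d \<beta>))
       \<and> (C_il \<alpha> \<inter> C_fr d \<beta> \<noteq> {} \<longrightarrow> shortest_is LRL \<alpha> d \<beta>)"
proof -
  have meet_lr: "C_il \<alpha> \<inter> C_fr d \<beta> \<noteq> {} \<longleftrightarrow> (d + sin \<alpha> + sin \<beta>)\<^sup>2 + (cos \<alpha> + cos \<beta>)\<^sup>2 \<le> 4"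
  proof -
    have "(- sin \<alpha> - (d + sin \<beta>))\<^sup>2 + (cos \<alpha> - (- cos \<beta>))\<^sup>2 = (d + sin \<alpha> + sin \<beta>)\<^sup>2 + (cos \<alpha> + cos \<beta>)\<^sup>2"
      by algebra
    then show ?thesis unfolding C_il_def C_fr_def ucircle_meet_iff by simp
  qed
  have meet_rl: "C_ir \<alpha> \<inter> C_fl d \<beta> \<noteq> {} \<longleftrightarrow> (d - sin \<alpha> - sin \<beta>)\<^sup>2 + (cos \<alpha> + cos \<beta>)\<^sup>2 \<le> 4"
  proof -
    have "(sin \<alpha> - (d - sin \<beta>))\<^sup>2 + (- cos \<alpha> - cos \<beta>)\<^sup>2 = (d - sin \<alpha> - sin \<beta>)\<^sup>2 + (cos \<alpha> + cos \<beta>)\<^sup>2"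
      by algebra
    then show ?thesis unfolding C_ir_def C_fl_def ucircle_meet_iff by simp
  qed
  have meet_ll: "C_il \<alpha> \<inter> C_fl d \<beta> \<noteq> {} \<longleftrightarrow> (d - sin \<beta> + sin \<alpha>)\<^sup>2 + (cos \<beta> - cos \<alpha>)\<^sup>2 \<le> 4"
  proof -
    have "(- sin \<alpha> - (d - sin \<beta>))\<^sup>2 + (cos \<alpha> - cos \<beta>)\<^sup>2 = (d - sin \<beta> + sin \<alpha>)\<^sup>2 + (cos \<beta> - cos \<alpha>)\<^sup>2"
      by algebra
    then show ?thesis unfolding C_il_def C_fl_def ucircle_meet_iff by simp
  qed
  have meet_rr: "C_ir \<alpha> \<inter> C_fr d \<beta> \<noteq> {} \<longleftrightarrow> (d + sin \<beta> - sin \<alpha>)\<^sup>2 + (cos \<alpha> - cos \<beta>)\<^sup>2 \<le> 4"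
  proof -
    have "(sin \<alpha> - (d + sin \<beta>))\<^sup>2 + (- cos \<alpha> - (- cos \<beta>))\<^sup>2 = (d + sin \<beta> - sin \<alpha>)\<^sup>2 + (cos \<alpha> - cos \<beta>)\<^sup>2"
      by algebra
    then show ?thesis unfolding C_ir_def C_fr_def ucircle_meet_iff by simp
  qed
  note sg = quadrant_signs[OF assms(2-5)]
  have "C_il \<alpha> \<inter> C_fl d \<beta> \<noteq> {} \<or> C_ir \<alpha> \<inter> C_fr d \<beta> \<noteq> {} \<or> C_il \<alpha> \<inter> C_fr d \<beta> \<noteq> {} \<or> C_ir \<alpha> \<inter> C_fl d \<beta> \<noteq> {}"
    using assms(6) by blast
  then have "(d - sin \<alpha> - sin \<beta>)\<^sup>2 + (cos \<alpha> + cos \<beta>)\<^sup>2 \<le> 4"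
    unfolding meet_lr meet_rl meet_ll meet_rr using short_path_imp_ir_fl_meet[OF assms(1) sg] by blast
  then obtain \<theta> \<psi> a b where "short_a12 \<alpha> \<beta> d \<theta> \<psi> a b"
    using short_a12_exists[OF assms(1-5)] by blast
  then interpret short_a12 \<alpha> \<beta> d \<theta> \<psi> a b .
  have far_iff: "C_il \<alpha> \<inter> C_fr d \<beta> = {} \<longleftrightarrow> far" using meet_lr unfolding far_def not_le[symmetric] by blast
  have t_rsr: "tlen RSR \<alpha> d \<beta> = (if \<theta> \<le> \<alpha> then \<alpha> - \<theta> else \<alpha> - \<theta> + 2 * pi)"
    by (simp add: tlen_def seglens_RSR)
  \<comment> \<open>The first branch of \<open>t_rsr\<close> is at most \<open>pi / 2\<close>, the
    second at least \<open>pi\<close>.\<close>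
  have t_lt: "tlen RSR \<alpha> d \<beta> < pi \<Longrightarrow> \<theta> \<le> \<alpha>"
    using \<theta> ab t_rsr by (auto split: if_splits)
  have t_gt: "tlen RSR \<alpha> d \<beta> > pi \<Longrightarrow> \<alpha> < \<theta>"
    using \<theta> ab t_rsr by (auto split: if_splits)
  \<comment> \<open>For \<open>\<theta> \<le> \<alpha>\<close> this is the length of the standard
    RLR path minus that of RSR; likewise \<open>S2\<close> below is RLR minus LSR.\<close>
  have S1: "S1 = 2 * pi - 4 * a - 4 * sin a"
    by (simp add: S1_def plen_def seglens_RLR seglens_RSR)
  have ii: "(S2 < 0 \<longrightarrow> shortest_is RLR \<alpha> d \<beta>) \<and> (S2 > 0 \<longrightarrow> shortest_is LSR \<alpha> d \<beta>)"
    if far: far and gt: "\<alpha> < \<theta>"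
  proof -
    obtain t p q where LSR: "dubins_path LSR \<alpha> d \<beta> t p q" using LSR_exists[OF far gt] .
    have "S2 = 4 * pi - 4 * a - (\<beta> - \<alpha>) - (t + p + q)"
      using LSR_case_ii(5)[OF far gt LSR]
      by (simp add: S2_def tlen_def plen_def qlen_def seglens_RLR seglens_LSR[OF far gt LSR])
    then show ?thesis using case_ii_shortest[OF far gt LSR] by auto
  qed
  show ?thesis
    unfolding far_iff S1 using case_i_shortest t_lt t_gt ii near_shortest by auto
qed

end
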